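(* Fix $x\in(0,+\infty)$ and let $n=n(d)$ be a sequence of natural numbers (indexed by integers $d\ge 2$) of the form $$n=\Bigl(\frac{d}{2x+o(1)}\Bigr)^{d/2},$$ where $o(1)$ denotes a real sequence converging to $0$ as $d\to\infty$. Then $$\mathbf{E}\, f_0(P_{n,d}^0)\sim (1-e^{-x})\,n\qquad\text{as } d\to\infty.$$
   Context: $P_{n,d}^0$ is the convex hull of $n$ i.i.d. random points distributed uniformly in the Euclidean unit ball $\mathbb{B}^d$ of $\mathbb{R}^d$ (the beta polytope with parameter $\beta=0$). For a polytope $P$, $f_0(P)$ denotes its number of vertices. $\mathbf{E}$ denotes expectation. For sequences $a(d),b(d)$, $a\sim b$ means $a(d)/b(d)\to 1$ as $d\to\infty$. *)

theory Defs
  imports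
    "HOL-Probability.Probability"
    "HOL-Library.Function_Algebras"
    "HOL-Library.Landau_Symbols"
begin

text \<open>
  The dimension \<open>d\<close> tends to infinity, so it cannot be a type. A point of \<open>\<real>\<^sup>d\<close> is an element of
  \<open>{..<d} \<rightarrow>\<^sub>E UNIV\<close>, the space of \<open>Pi\<^sub>M {..<d} (\<lambda>_. lborel)\<close>, i.e. a function on \<open>nat\<close> whose values
  outside \<open>{..<d}\<close> are the fixed real \<open>undefined\<close>. With the pointwise vector space structure on
  \<open>nat \<Rightarrow> real\<close> these functions form an affine subspace that restriction to \<open>{..<d}\<close> identifies
  affinely with \<open>\<real>\<^sup>d\<close>; hence convex hulls and extreme points taken in \<open>nat \<Rightarrow> real\<close> are those of \<open>\<real>\<^sup>d\<close>.
\<close>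

instantiation "fun" :: (type, real_vector) real_vector
begin

definition scaleR_fun_def: "scaleR r f = (\<lambda>x. r *\<^sub>R f x)"

instance
  by standard (simp_all add: scaleR_fun_def fun_eq_iff scaleR_add_right scaleR_add_left)

end

definition unit_ball :: "nat \<Rightarrow> (nat \<Rightarrow> real) set" where
  "unit_ball d = {y \<in> {..<d} \<rightarrow>\<^sub>E UNIV. L2_set y {..<d} \<le> 1}"

definition unif_ball :: "nat \<Rightarrow> (nat \<Rightarrow> real) measure" where
  "unif_ball d = uniform_measure (Pi\<^sub>M {..<d} (\<lambda>_. lborel)) (unit_ball d)"

definition f0 :: "'a::real_vector set \<Rightarrow> nat" where
  "f0 P = card {v. v extreme_point_of P}"

text \<open>The sample space is the \<open>n\<close>-fold product, so that the coordinates \<open>X i\<close>, \<open>i < n\<close>, are i.i.d.\<close>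

definition expected_f0 :: "nat \<Rightarrow> nat \<Rightarrow> real" where
  "expected_f0 n d =
     (\<integral>X. real (f0 (convex hull (X ` {..<n}))) \<partial>(Pi\<^sub>M {..<n} (\<lambda>_. unif_ball d)))"

end

theory Submission
  imports Defs "HOL-Real_Asymp.Real_Asymp"
begin

text \<open>
  A uniform point of the ball lies at distance more than \<open>1 - y / d\<close> from the origin with probability
  tending to \<open>1 - exp (- y)\<close>, and the transition between vertices and interior points happens at
  \<open>y = x\<close>. A sample point \<open>v\<close> of norm more than \<open>\<rho> = 1 - y / d\<close> is a vertex unless another sample point
  lies within \<open>sqrt (1 - \<rho>\<^sup>2)\<close> of it, and for \<open>y < x\<close> the expected number of such points vanishes.
  If a sample point of norm at most \<open>\<rho>\<close> is a vertex, some cap at distance about \<open>\<rho>\<close> from the origin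
  contains no sample point; for \<open>y > x\<close> such a cap is expected to contain exponentially (in \<open>d\<close>) many
  points, so that a union bound over \<open>exp (O (d log d))\<close> directions makes this improbable.
\<close>

section \<open>Separation and extreme points\<close>

text \<open>Why the transition is at \<open>y = x\<close>: for \<open>\<rho> = 1 - y / d\<close> the
  number \<open>1 - \<rho>\<^sup>2\<close> is about \<open>2 * y / d\<close>, so a ball of radius
  \<open>sqrt (1 - \<rho>\<^sup>2)\<close> has relative volume about
  \<open>(2 * y / d) powr (d / 2)\<close>, and \<open>n\<close> times this is about
  \<open>(y / x) powr (d / 2)\<close>. A cap at distance \<open>\<rho>\<close> has the same relative
  volume up to a factor polynomial in \<open>d\<close>. Since the ratio \<open>y / x\<close> is
  raised to the power \<open>d / 2\<close>, such factors are harmless and crude volume bounds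
  suffice; the exact volume of the ball never enters. The cap left empty by an inner vertex depends
  on the sample. Replacing its normal by a vector of a fixed finite grid makes independence
  applicable; the rounding error must be small against \<open>1 / d\<close>, the scale on which all
  relevant distances to the sphere vary. As \<open>d\<close> is a variable, the geometry is done
  with sums over the first \<open>d\<close> coordinates of functions
  \<open>nat \<Rightarrow> real\<close> under the product topology.\<close>

abbreviation inner_on :: "nat \<Rightarrow> (nat \<Rightarrow> real) \<Rightarrow> (nat \<Rightarrow> real) \<Rightarrow> real" where
  "inner_on d u v \<equiv> \<Sum>i<d. u i * v i"

abbreviation points :: "nat \<Rightarrow> (nat \<Rightarrow> real) set" where
  "points d \<equiv> {..<d} \<rightarrow>\<^sub>E UNIV"

lemma inner_on_le_L2_set: "inner_on d u v \<le> L2_set u {..<d} * L2_set v {..<d}"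
proof -
  have "inner_on d u v \<le> (\<Sum>i<d. \<bar>u i\<bar> * \<bar>v i\<bar>)"
    by (rule sum_mono) (metis abs_ge_self abs_mult)
  then show ?thesis using L2_set_mult_ineq[of u v "{..<d}"] by linarith
qed

lemma inner_on_self: "inner_on d u u = (L2_set u {..<d})\<^sup>2"
  by (simp add: L2_set_def sum_nonneg power2_eq_square)

lemma compact_convex_hull_finite_fun:
  \<comment> \<open>By induction: the hull of \<open>insert a S\<close> is the image of
    \<open>{0..1} \<times> (convex hull S)\<close> under a map that is continuous in each
    coordinate, which is all that the product topology asks for. Compactness provides the nearest
    point used for separation.\<close>
  fixes S :: "('a \<Rightarrow> real) set"
  assumes "finite S"
  shows "compact (convex hull S)"
  using assms
proof (induction S)
  case empty
  then show ?case by simp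
next
  case (insert a S)
  show ?case
  proof (cases "S = {}")
    case True
    then show ?thesis by simp
  next
    case False
    let ?f = "\<lambda>p :: real \<times> ('a \<Rightarrow> real). (\<lambda>i. (1 - fst p) * a i + fst p * snd p i)"
    have "continuous_on ({0..1} \<times> (convex hull S)) ?f"
    proof (rule continuous_on_coordinatewise_then_product)
      fix i
      have "continuous_on ({0..1} \<times> (convex hull S)) (\<lambda>p. snd p i)"
        by (rule continuous_on_product_then_coordinatewise) (intro continuous_intros)
      then show "continuous_on ({0..1} \<times> (convex hull S)) (\<lambda>p. ?f p i)"
        by (intro continuous_intros)
    qed
    then have "compact (?f ` ({0..1} \<times> (convex hull S)))"
      using insert.IH by (intro compact_continuous_image compact_Times) auto
    moreover have "?f ` ({0..1} \<times> (convex hull S)) = convex hull (insert a S)"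
    proof -
      have "?f p = (1 - fst p) *\<^sub>R a + fst p *\<^sub>R snd p" for p
        by (auto simp: scaleR_fun_def fun_eq_iff)
      then show ?thesis
        unfolding convex_hull_insert_alt using False by (force simp: image_def)
    qed
    ultimately show ?thesis by simp
  qed
qed

text \<open>Weights that add up to 1 preserve the common value \<open>undefined\<close> outside
  \<open>{..<d}\<close>.\<close>

lemma convex_points: "convex (points d)"
  by (auto simp: convex_def PiE_def extensional_def scaleR_fun_def simp flip: distrib_right)

text \<open>The normal is \<open>z - p\<close>, where \<open>p\<close> is the point of the hull
  nearest to \<open>z\<close> in the first \<open>d\<close> coordinates.\<close>

lemma separate_point_convex_hull:
  assumes S: "finite S" "S \<subseteq> points d" and z: "z \<in> points d" "z \<notin> convex hull S"
  obtains w where "\<And>v. v \<in> S \<Longrightarrow> inner_on d w v < inner_on d w z"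
proof (cases "S = {}")
  case True
  then show ?thesis using that by auto
next
  case False
  define f where "f = (\<lambda>y :: nat \<Rightarrow> real. \<Sum>i<d. (z i - y i)\<^sup>2)"
  have "continuous_on (convex hull S) f"
    unfolding f_def by (intro continuous_intros continuous_on_product_then_coordinatewise)
  then obtain p where p: "p \<in> convex hull S" and pmin: "\<And>y. y \<in> convex hull S \<Longrightarrow> f p \<le> f y"
    using continuous_attains_inf[OF compact_convex_hull_finite_fun[OF S(1)]] False
    by (metis convex_hull_eq_empty)
  define w where "w = (\<lambda>i. z i - p i)"
  \<comment> \<open>Outside \<open>{..<d}\<close> both \<open>z\<close> and \<open>p\<close> are
    \<open>undefined\<close>, so they must differ in a coordinate that \<open>inner_on d\<close>
    sees.\<close>
  have "p \<in> points d"
    using p hull_minimal[of S "points d" convex] S(2) convex_points by blast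
  then have "\<exists>i<d. w i \<noteq> 0"
    using z p unfolding w_def by (metis PiE_ext eq_iff_diff_eq_0 lessThan_iff)
  then have wpos: "inner_on d w w > 0"
    by (meson finite_lessThan lessThan_iff not_real_square_gt_zero sum_pos2 zero_le_square)
  have "inner_on d w v < inner_on d w z" if v: "v \<in> S" for v
  proof -
    define a where "a = (\<Sum>i<d. w i * (v i - p i))"
    define b where "b = (\<Sum>i<d. (v i - p i)\<^sup>2)"
    have b: "b \<ge> 0" by (simp add: b_def sum_nonneg)
    \<comment> \<open>First-order condition at the minimum: going a fraction \<open>t\<close> from
      \<open>p\<close> towards \<open>v\<close> changes \<open>f\<close> by
      \<open>- 2 * t * a + t * t * b\<close>, which cannot be negative.\<close>
    have ineq: "2 * a \<le> t * b" if t: "0 < t" "t \<le> 1" for t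
    proof -
      have "(1 - t) *\<^sub>R p + t *\<^sub>R v \<in> convex hull S"
        using t p hull_inc[OF v] by (intro convexD_alt convex_convex_hull) auto
      from pmin[OF this] have "f p \<le> (\<Sum>i<d. (w i - t * (v i - p i))\<^sup>2)"
        by (simp add: f_def w_def scaleR_fun_def algebra_simps)
      also have "\<dots> = f p - 2 * t * a + t * t * b"
        unfolding f_def a_def b_def w_def sum_distrib_left sum_subtractf[symmetric] sum.distrib[symmetric]
        by (intro sum.cong) (auto simp: power2_eq_square algebra_simps)
      finally have "t * (2 * a) \<le> t * (t * b)" by (simp add: algebra_simps)
      then show ?thesis using t by (simp add: mult_le_cancel_left)
    qed
    have "a \<le> 0"
    proof (rule ccontr)
      assume "\<not> a \<le> 0"
      then have a: "a > 0" by simp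
      \<comment> \<open>Small enough for \<open>t * b \<le> a\<close>, which contradicts
        \<open>2 * a \<le> t * b\<close>; the \<open>+ 1\<close> covers
        \<open>b = 0\<close>.\<close>
      define t where "t = min 1 (a / (b + 1))"
      have "t * b \<le> a / (b + 1) * b" using b by (intro mult_right_mono) (auto simp: t_def)
      also have "\<dots> \<le> a" using a b by (simp add: field_simps)
      finally show False using ineq[of t] a b by (auto simp: t_def)
    qed
    then have "inner_on d w v \<le> inner_on d w p"
      by (simp add: a_def algebra_simps sum_subtractf)
    moreover have "inner_on d w w = inner_on d w z - inner_on d w p"
      by (simp add: w_def sum_subtractf[symmetric] right_diff_distrib[symmetric])
    ultimately show ?thesis using wpos by linarith
  qed
  then show ?thesis using that by blast
qed

text \<open>The open half-space below the level of \<open>v\<close>, together with \<open>v\<close>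
  itself, is a convex set \<open>?C\<close> containing the hull. A proper mixture of two points of
  \<open>?C\<close> stays strictly below that level unless both are \<open>v\<close>.\<close>

lemma extreme_pointI_strict_max:
  assumes v: "v \<in> S" and w: "\<And>y. y \<in> S \<Longrightarrow> y = v \<or> inner_on d w y < inner_on d w v"
  shows "v extreme_point_of (convex hull S)"
proof -
  have lin: "inner_on d w (p *\<^sub>R a + q *\<^sub>R b) = p * inner_on d w a + q * inner_on d w b" for p q a b
    by (simp add: scaleR_fun_def sum_distrib_left algebra_simps sum.distrib)
  let ?C = "{y. y = v \<or> inner_on d w y < inner_on d w v}"
  have mix: "(1 - t) * a + t * b < c"
    if "0 < t" "t < 1" "a \<le> c" "b \<le> c" "a < c \<or> b < c" for t a b c :: real
  proof -
    have "(1 - t) * a \<le> (1 - t) * c" "t * b \<le> t * c" using that by auto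
    moreover have "(1 - t) * a < (1 - t) * c \<or> t * b < t * c" using that by auto
    ultimately have "(1 - t) * a + t * b < (1 - t) * c + t * c" by linarith
    then show ?thesis by (simp add: algebra_simps)
  qed
  have mixC: "(1 - t) *\<^sub>R a + t *\<^sub>R b = v \<Longrightarrow> a = v \<and> b = v"
    "(1 - t) *\<^sub>R a + t *\<^sub>R b \<in> ?C"
    if "a \<in> ?C" "b \<in> ?C" "0 < t" "t < 1" for a b t
  proof -
    have "a = v \<and> b = v \<or> inner_on d w ((1 - t) *\<^sub>R a + t *\<^sub>R b) < inner_on d w v"
      using that mix[of t "inner_on d w a" "inner_on d w v" "inner_on d w b"] unfolding lin by auto
    then show "(1 - t) *\<^sub>R a + t *\<^sub>R b = v \<Longrightarrow> a = v \<and> b = v" "(1 - t) *\<^sub>R a + t *\<^sub>R b \<in> ?C"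
      by (auto simp: scaleR_left.diff)
  qed
  have "convex ?C"
    unfolding convex_alt
  proof (intro ballI allI impI)
    fix a b t assume *: "a \<in> ?C" "b \<in> ?C" "0 \<le> t \<and> t \<le> (1::real)"
    then consider "t = 0" | "t = 1" | "0 < t \<and> t < 1" by linarith
    then show "(1 - t) *\<^sub>R a + t *\<^sub>R b \<in> ?C"
      using * mixC(2) by cases auto
  qed
  then have sub: "convex hull S \<subseteq> ?C" using w by (intro hull_minimal) auto
  show ?thesis
    unfolding extreme_point_of_def
  proof (intro conjI ballI notI)
    show "v \<in> convex hull S" using v by (rule hull_inc)
    fix a b assume ab: "a \<in> convex hull S" "b \<in> convex hull S" "v \<in> open_segment a b"
    then obtain t where t: "a \<noteq> b" "0 < t" "t < 1" "v = (1 - t) *\<^sub>R a + t *\<^sub>R b"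
      by (auto simp: in_segment)
    have "a \<in> ?C" "b \<in> ?C" using sub ab by blast+
    from mixC(1)[OF this t(2,3) t(4)[symmetric]] t(1) show False by blast
  qed
qed

text \<open>A convex set stays convex when an extreme point is removed, so the hull of the remaining
  points cannot reach \<open>v\<close>.\<close>

lemma extreme_point_convex_hullD:
  assumes "v extreme_point_of (convex hull S)"
  shows "v \<in> S" "v \<notin> convex hull (S - {v})"
proof -
  show vS: "v \<in> S" using assms by (rule extreme_point_of_convex_hull)
  show "v \<notin> convex hull (S - {v})"
  proof
    have "convex (convex hull S - {v})"
      using assms by (simp add: extreme_point_of_stillconvex)
    moreover have "S - {v} \<subseteq> convex hull S - {v}" by (auto intro: hull_inc)
    ultimately have "convex hull (S - {v}) \<subseteq> convex hull S - {v}" by (intro hull_minimal)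
    moreover assume "v \<in> convex hull (S - {v})"
    ultimately show False by blast
  qed
qed

text \<open>The functionals range over a countable set, which makes vertex sets measurable.\<close>

lemma extreme_point_iff_dense:
  assumes D: "\<And>U :: (nat \<Rightarrow> real) set. open U \<Longrightarrow> U \<noteq> {} \<Longrightarrow> \<exists>w\<in>D. w \<in> U"
    and S: "finite S" "S \<subseteq> points d" "v \<in> S"
  shows "v extreme_point_of (convex hull S) \<longleftrightarrow>
           (\<exists>w\<in>D. \<forall>y\<in>S. y = v \<or> inner_on d w y < inner_on d w v)"
proof
  assume ext: "v extreme_point_of (convex hull S)"
  \<comment> \<open>Finitely many strict inequalities, each involving finitely many coordinates of
    \<open>w\<close>, define an open set; separation shows that it is nonempty, and so
    \<open>D\<close> meets it.\<close>
  let ?U = "\<Inter>y\<in>S - {v}. {w. inner_on d w y < inner_on d w v}"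
  have "open ?U"
    using S(1)
    by (intro open_INT finite_Diff ballI open_Collect_less continuous_intros
        continuous_on_product_then_coordinatewise) auto
  moreover have "?U \<noteq> {}"
  proof -
    from S have "finite (S - {v})" "S - {v} \<subseteq> points d" "v \<in> points d" by auto
    from this extreme_point_convex_hullD(2)[OF ext]
    obtain w where "\<And>y. y \<in> S - {v} \<Longrightarrow> inner_on d w y < inner_on d w v"
      by (rule separate_point_convex_hull) blast
    then have "w \<in> ?U" by blast
    then show ?thesis by (simp only: ex_in_conv[symmetric]) (rule exI)
  qed
  ultimately obtain w where "w \<in> D" "w \<in> ?U" using D by blast
  then show "\<exists>w\<in>D. \<forall>y\<in>S. y = v \<or> inner_on d w y < inner_on d w v" by blast
next
  assume "\<exists>w\<in>D. \<forall>y\<in>S. y = v \<or> inner_on d w y < inner_on d w v"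
  then show "v extreme_point_of (convex hull S)"
    using S(3) extreme_pointI_strict_max by blast
qed

section \<open>Volumes of balls and caps\<close>

abbreviation volume :: "nat \<Rightarrow> (nat \<Rightarrow> real) measure" where
  "volume d \<equiv> Pi\<^sub>M {..<d} (\<lambda>_. lborel)"

section \<open>Measurability of coordinates, functionals and norms\<close>

lemma measurable_coord [measurable]:
  assumes "i < d"
  shows "(\<lambda>y. y i) \<in> borel_measurable (volume d)"
proof -
  have "(\<lambda>y. y i) \<in> measurable (volume d) lborel"
    using assms by (intro measurable_component_singleton) auto
  then show ?thesis by simp
qed

lemma measurable_inner_on [measurable]: "(\<lambda>y. inner_on d u y) \<in> borel_measurable (volume d)"
  by (intro borel_measurable_sum borel_measurable_times measurable_coord) auto

lemma measurable_L2_set_diff [measurable]: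
  "(\<lambda>y. L2_set (\<lambda>i. y i - c i) {..<d}) \<in> borel_measurable (volume d)"
  unfolding L2_set_def
  by (intro borel_measurable_sqrt[THEN measurable_compose[rotated]] borel_measurable_sum
        borel_measurable_power borel_measurable_diff measurable_coord) auto

lemma measurable_L2_set [measurable]: "(\<lambda>y. L2_set y {..<d}) \<in> borel_measurable (volume d)"
  using measurable_L2_set_diff[of "\<lambda>_. 0" d] by simp

lemma space_volume [simp]: "space (volume d) = points d"
  by (simp add: space_PiM)

lemma sets_unit_ball [measurable]: "unit_ball d \<in> sets (volume d)"
proof -
  have "{y \<in> space (volume d). L2_set y {..<d} \<le> 1} \<in> sets (volume d)" by measurable
  then show ?thesis by (simp add: unit_ball_def)
qed

section \<open>Affine changes of variables\<close>

lemma emeasure_lborel_affine: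
  assumes "c \<noteq> 0" "A \<in> sets borel"
  shows "emeasure lborel A = ennreal \<bar>c\<bar> * emeasure lborel {y. b + c * y \<in> A}"
proof -
  have "emeasure lborel A = emeasure (density (distr lborel borel (\<lambda>x. b + c * x)) (\<lambda>_. ennreal \<bar>c\<bar>)) A"
    using lborel_real_affine[OF assms(1), of b] by simp
  also have "\<dots> = ennreal \<bar>c\<bar> * emeasure (distr lborel borel (\<lambda>x. b + c * x)) A"
    using assms(2) by (simp add: emeasure_density nn_integral_cmult)
  also have "emeasure (distr lborel borel (\<lambda>x. b + c * x)) A = emeasure lborel {y. b + c * y \<in> A}"
    using assms(2) by (simp add: emeasure_distr vimage_def)
  finally show ?thesis .
qed

text \<open>Boxes determine the product measure, and on a box each coordinate contributes one factor
  \<open>\<bar>c\<bar>\<close>. The cases used later are dilation (\<open>c = r\<close>),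
  translation (\<open>c = 1\<close>) and point reflection (\<open>c = -1\<close>).\<close>

lemma emeasure_volume_affine:
  assumes c: "c \<noteq> 0" and S: "S \<in> sets (volume d)"
  shows "emeasure (volume d) S =
    ennreal (\<bar>c\<bar> ^ d) * emeasure (volume d) {y \<in> points d. (\<lambda>i\<in>{..<d}. b i + c * y i) \<in> S}"
proof -
  interpret product_sigma_finite "\<lambda>_::nat. lborel :: real measure" ..
  let ?T = "\<lambda>y. \<lambda>i\<in>{..<d}. b i + c * y i"
  have T [measurable]: "?T \<in> measurable (volume d) (volume d)"
    by (intro measurable_restrict) (auto intro!: borel_measurable_add borel_measurable_times measurable_coord)
  let ?N = "scale_measure (ennreal (\<bar>c\<bar> ^ d)) (distr (volume d) (volume d) ?T)"
  have "?N = volume d"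
  proof (rule PiM_eqI)
    fix A :: "nat \<Rightarrow> real set" assume A: "\<And>i. i \<in> {..<d} \<Longrightarrow> A i \<in> sets lborel"
    have "emeasure (distr (volume d) (volume d) ?T) (Pi\<^sub>E {..<d} A)
          = emeasure (volume d) (?T -` Pi\<^sub>E {..<d} A \<inter> space (volume d))"
      using A by (intro emeasure_distr T sets_PiM_I_finite) auto
    also have "?T -` Pi\<^sub>E {..<d} A \<inter> space (volume d) = Pi\<^sub>E {..<d} (\<lambda>i. {y. b i + c * y \<in> A i})"
      by (auto simp: PiE_def Pi_def extensional_def)
    also have "emeasure (volume d) \<dots> = (\<Prod>i<d. emeasure lborel {y. b i + c * y \<in> A i})"
    proof (rule emeasure_PiM)
      fix i assume "i \<in> {..<d}"
      then have [measurable]: "A i \<in> sets borel" using A by simp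
      show "{y. b i + c * y \<in> A i} \<in> sets lborel" by simp
    qed auto
    finally have "emeasure ?N (Pi\<^sub>E {..<d} A)
        = ennreal (\<bar>c\<bar> ^ d) * (\<Prod>i<d. emeasure lborel {y. b i + c * y \<in> A i})"
      by (simp only: emeasure_scale_measure)
    also have "\<dots> = (\<Prod>i<d. ennreal \<bar>c\<bar> * emeasure lborel {y. b i + c * y \<in> A i})"
      by (simp add: prod.distrib ennreal_power)
    also have "\<dots> = (\<Prod>i<d. emeasure lborel (A i))"
      using A by (intro prod.cong refl emeasure_lborel_affine[symmetric] c) auto
    finally show "emeasure ?N (Pi\<^sub>E {..<d} A) = (\<Prod>i\<in>{..<d}. emeasure lborel (A i))" .
  qed auto
  then have "emeasure (volume d) S = emeasure ?N S" by simp
  also have "\<dots> = ennreal (\<bar>c\<bar> ^ d) * emeasure (volume d) (?T -` S \<inter> space (volume d))"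
    using S by (simp add: emeasure_distr)
  also have "?T -` S \<inter> space (volume d) = {y \<in> points d. ?T y \<in> S}" by auto
  finally show ?thesis .
qed

lemma emeasure_volume_ball:
  assumes "r > 0"
  shows "emeasure (volume d) {y \<in> points d. L2_set (\<lambda>i. y i - c i) {..<d} \<le> r}
           = ennreal (r ^ d) * emeasure (volume d) (unit_ball d)"
proof -
  have "{y \<in> space (volume d). L2_set (\<lambda>i. y i - c i) {..<d} \<le> r} \<in> sets (volume d)" by measurable
  then have "emeasure (volume d) {y \<in> points d. L2_set (\<lambda>i. y i - c i) {..<d} \<le> r}
      = ennreal (\<bar>r\<bar> ^ d) * emeasure (volume d) {y \<in> points d. (\<lambda>i\<in>{..<d}. c i + r * y i)
          \<in> {y \<in> points d. L2_set (\<lambda>i. y i - c i) {..<d} \<le> r}}"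
    using assms by (intro emeasure_volume_affine) auto
  also have "{y \<in> points d. (\<lambda>i\<in>{..<d}. c i + r * y i)
          \<in> {y \<in> points d. L2_set (\<lambda>i. y i - c i) {..<d} \<le> r}} = unit_ball d"
  proof -
    have "L2_set (\<lambda>i. (\<lambda>i\<in>{..<d}. c i + r * y i) i - c i) {..<d} = r * L2_set y {..<d}" for y
      using assms by (simp add: L2_set_right_distrib cong: L2_set_cong_simp)
    then have "L2_set (\<lambda>i. (\<lambda>i\<in>{..<d}. c i + r * y i) i - c i) {..<d} \<le> r \<longleftrightarrow> L2_set y {..<d} \<le> 1" for y
      using assms by simp
    moreover have "(\<lambda>i\<in>{..<d}. c i + r * y i) \<in> points d" for y
      by simp
    ultimately show ?thesis
      unfolding unit_ball_def by (intro Collect_cong) (simp only: mem_Collect_eq simp_thms)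
  qed
  finally show ?thesis using assms by simp
qed

text \<open>Probabilities are ratios in which the volume of the ball cancels; for this it only has
  to be positive and finite, which two cubes show.\<close>

lemma emeasure_unit_ball: "emeasure (volume d) (unit_ball d) \<noteq> 0" "emeasure (volume d) (unit_ball d) \<noteq> \<infinity>"
proof -
  interpret product_sigma_finite "\<lambda>_::nat. lborel :: real measure" ..
  have "unit_ball d \<subseteq> Pi\<^sub>E {..<d} (\<lambda>_. {-1..1})"
  proof
    fix y assume y: "y \<in> unit_ball d"
    have "y i \<in> {-1..1}" if "i < d" for i
    proof -
      have "\<bar>y i\<bar> = sqrt ((y i)\<^sup>2)" by simp
      also have "\<dots> \<le> L2_set y {..<d}"
        unfolding L2_set_def using that by (intro real_sqrt_le_mono member_le_sum) auto
      also have "\<dots> \<le> 1" using y by (simp add: unit_ball_def)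
      finally show ?thesis by (simp add: abs_le_iff minus_le_iff)
    qed
    with y show "y \<in> Pi\<^sub>E {..<d} (\<lambda>_. {-1..1})"
      unfolding unit_ball_def PiE_iff mem_Collect_eq lessThan_iff by blast
  qed
  then have "emeasure (volume d) (unit_ball d) \<le> emeasure (volume d) (Pi\<^sub>E {..<d} (\<lambda>_. {-1..1}))"
    by (intro emeasure_mono sets_PiM_I_finite) auto
  also have "\<dots> = (\<Prod>i<d. emeasure lborel {-1..1::real})" by (intro emeasure_PiM) auto
  also have "\<dots> < \<infinity>" by (simp add: prod_constant ennreal_power power_less_top_ennreal)
  finally show "emeasure (volume d) (unit_ball d) \<noteq> \<infinity>" by simp
  \<comment> \<open>Side \<open>1 / d\<close> works because the Euclidean norm is at most the sum of
    the nonnegative coordinates. For \<open>d = 0\<close> the volume is an empty product, hence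
    1.\<close>
  have "Pi\<^sub>E {..<d} (\<lambda>_. {0..1 / real d}) \<subseteq> unit_ball d"
  proof
    fix y assume y: "y \<in> Pi\<^sub>E {..<d} (\<lambda>_. {0..1 / real d})"
    have "L2_set y {..<d} \<le> (\<Sum>i<d. y i)"
      using y by (intro L2_set_le_sum) (auto simp: PiE_def Pi_def)
    also have "\<dots> \<le> (\<Sum>i<d. 1 / real d)"
      using y by (intro sum_mono) (auto simp: PiE_def Pi_def)
    also have "\<dots> \<le> 1" by simp
    finally show "y \<in> unit_ball d" using y by (auto simp: unit_ball_def)
  qed
  then have "emeasure (volume d) (Pi\<^sub>E {..<d} (\<lambda>_. {0..1 / real d})) \<le> emeasure (volume d) (unit_ball d)"
    by (intro emeasure_mono) auto
  moreover have "emeasure (volume d) (Pi\<^sub>E {..<d} (\<lambda>_. {0..1 / real d})) = (\<Prod>i<d. emeasure lborel {0..1 / real d})"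
    by (intro emeasure_PiM) auto
  moreover have "\<dots> \<noteq> 0" by (cases d) auto
  ultimately show "emeasure (volume d) (unit_ball d) \<noteq> 0" by auto
qed

section \<open>The uniform distribution on the ball\<close>

lemma prob_space_unif_ball: "prob_space (unif_ball d)"
  unfolding unif_ball_def using emeasure_unit_ball by (intro prob_space_uniform_measure) auto

lemma sets_unif_ball [simp, measurable_cong]: "sets (unif_ball d) = sets (volume d)"
  by (simp add: unif_ball_def)

lemma space_unif_ball [simp]: "space (unif_ball d) = points d"
  by (simp add: unif_ball_def space_PiM)

lemma emeasure_unif_ball:
  "S \<in> sets (volume d) \<Longrightarrow>
     emeasure (unif_ball d) S = emeasure (volume d) (unit_ball d \<inter> S) / emeasure (volume d) (unit_ball d)"
  by (simp add: unif_ball_def)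

text \<open>The centre will be another sample point, so the small ball may stick out of the unit
  ball; hence an inequality, in contrast to the centred case.\<close>

lemma emeasure_unif_ball_ball_le:
  assumes "r > 0"
  shows "emeasure (unif_ball d) {y \<in> points d. L2_set (\<lambda>i. y i - c i) {..<d} \<le> r} \<le> ennreal (r ^ d)"
proof -
  let ?B = "{y \<in> points d. L2_set (\<lambda>i. y i - c i) {..<d} \<le> r}"
  have "{y \<in> space (volume d). L2_set (\<lambda>i. y i - c i) {..<d} \<le> r} \<in> sets (volume d)" by measurable
  then have B: "?B \<in> sets (volume d)" by simp
  have "emeasure (unif_ball d) ?B = emeasure (volume d) (unit_ball d \<inter> ?B) / emeasure (volume d) (unit_ball d)"
    using B by (rule emeasure_unif_ball)
  also have "\<dots> \<le> emeasure (volume d) ?B / emeasure (volume d) (unit_ball d)"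
    using B by (intro divide_right_mono_ennreal emeasure_mono) auto
  also have "\<dots> = ennreal (r ^ d)"
    using emeasure_unit_ball[of d] assms
    by (simp add: emeasure_volume_ball ennreal_mult_divide_eq)
  finally show ?thesis .
qed

lemma measure_unif_ball_norm_le:
  assumes "0 < r" "r \<le> 1"
  shows "measure (unif_ball d) {y \<in> points d. L2_set y {..<d} \<le> r} = r ^ d"
proof -
  let ?B = "{y \<in> points d. L2_set y {..<d} \<le> r}"
  have "{y \<in> space (volume d). L2_set y {..<d} \<le> r} \<in> sets (volume d)" by measurable
  then have B: "?B \<in> sets (volume d)" by simp
  have "?B \<subseteq> unit_ball d"
    unfolding unit_ball_def using assms(2) order_trans by blast
  then have "unit_ball d \<inter> ?B = ?B" by (rule Int_absorb1)
  then have "emeasure (unif_ball d) ?B = emeasure (volume d) ?B / emeasure (volume d) (unit_ball d)"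
    using B by (simp add: emeasure_unif_ball)
  also have "\<dots> = ennreal (r ^ d)"
    using emeasure_unit_ball[of d] assms emeasure_volume_ball[of r d "\<lambda>_. 0"]
    by (simp add: ennreal_mult_divide_eq)
  finally show ?thesis using assms by (simp add: measure_def)
qed

lemma AE_unif_ball: "AE y in unif_ball d. L2_set y {..<d} \<le> 1"
  unfolding unif_ball_def
  by (rule AE_uniform_measureI) (auto simp: unit_ball_def)

section \<open>Lower bounds for cap volumes\<close>

lemma L2_set_add_scaled:
  assumes "L2_set u {..<d} = 1"
  shows "(L2_set (\<lambda>i. a * u i + y i) {..<d})\<^sup>2 = (L2_set y {..<d})\<^sup>2 + 2 * a * inner_on d u y + a\<^sup>2"
proof -
  have "inner_on d (\<lambda>i. a * u i + y i) (\<lambda>i. a * u i + y i)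
      = inner_on d y y + 2 * a * inner_on d u y + a\<^sup>2 * inner_on d u u"
    unfolding sum_distrib_left sum.distrib[symmetric]
    by (intro sum.cong) (auto simp: power2_eq_square algebra_simps)
  then show ?thesis using assms by (simp only: inner_on_self) simp
qed

lemma inner_on_add_scaled:
  assumes "L2_set u {..<d} = 1"
  shows "inner_on d u (\<lambda>i. a * u i + y i) = a + inner_on d u y"
proof -
  have "inner_on d u (\<lambda>i. a * u i + y i) = a * inner_on d u u + inner_on d u y"
    unfolding sum_distrib_left sum.distrib[symmetric]
    by (intro sum.cong) (auto simp: algebra_simps)
  then show ?thesis using assms by (simp only: inner_on_self) simp
qed

lemma emeasure_volume_translate:
  assumes "S \<in> sets (volume d)"
  shows "emeasure (volume d) S = emeasure (volume d) {y \<in> points d. (\<lambda>i\<in>{..<d}. b i + y i) \<in> S}"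
  using emeasure_volume_affine[of 1 S d b] assms by simp

lemma L2_set_restrict [simp]: "L2_set (restrict f A) A = L2_set f A"
  by (rule L2_set_cong) auto

text \<open>Moving a parallel slab of a centred ball towards the centre keeps it inside the ball, so
  the central slab has the largest volume of those covering the half ball.\<close>

lemma central_slab_volume:
  assumes u: "L2_set u {..<d} = 1" and "s > 0" "\<eta> > 0" and K: "s < real K * \<eta>"
  shows "ennreal (s ^ d) * emeasure (volume d) (unit_ball d) \<le> of_nat (2 * K) *
    emeasure (volume d) {y \<in> points d. L2_set y {..<d} \<le> s \<and> 0 \<le> inner_on d u y \<and> inner_on d u y \<le> \<eta>}"
proof -
  define slab where "slab = (\<lambda>a b. {y \<in> points d. L2_set y {..<d} \<le> s \<and> a \<le> inner_on d u y \<and> inner_on d u y \<le> b})"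
  have slab_sets [measurable]: "slab a b \<in> sets (volume d)" for a b
  proof -
    have "{y \<in> space (volume d). L2_set y {..<d} \<le> s \<and> a \<le> inner_on d u y \<and> inner_on d u y \<le> b} \<in> sets (volume d)"
      by measurable
    then show ?thesis by (simp add: slab_def)
  qed
  have central: "emeasure (volume d) (slab (real k * \<eta>) (real (Suc k) * \<eta>)) \<le> emeasure (volume d) (slab 0 \<eta>)" for k
  proof -
    have "emeasure (volume d) (slab (real k * \<eta>) (real (Suc k) * \<eta>)) = emeasure (volume d)
        {y \<in> points d. (\<lambda>i\<in>{..<d}. real k * \<eta> * u i + y i) \<in> slab (real k * \<eta>) (real (Suc k) * \<eta>)}"
      by (rule emeasure_volume_translate) measurable
    also have "\<dots> \<le> emeasure (volume d) (slab 0 \<eta>)"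
    proof (rule emeasure_mono)
      show "{y \<in> points d. (\<lambda>i\<in>{..<d}. real k * \<eta> * u i + y i) \<in> slab (real k * \<eta>) (real (Suc k) * \<eta>)} \<subseteq> slab 0 \<eta>"
      proof safe
        fix y assume y: "y \<in> points d"
          and in_slab: "(\<lambda>i\<in>{..<d}. real k * \<eta> * u i + y i) \<in> slab (real k * \<eta>) (real (Suc k) * \<eta>)"
        let ?a = "real k * \<eta>"
        have "inner_on d u (\<lambda>i\<in>{..<d}. ?a * u i + y i) = inner_on d u (\<lambda>i. ?a * u i + y i)"
          by (intro sum.cong) auto
        then have ip: "inner_on d u (\<lambda>i\<in>{..<d}. ?a * u i + y i) = ?a + inner_on d u y"
          using inner_on_add_scaled[OF u] by simp
        have s: "L2_set (\<lambda>i. ?a * u i + y i) {..<d} \<le> s"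
          and "?a \<le> ?a + inner_on d u y" "?a + inner_on d u y \<le> real (Suc k) * \<eta>"
          using in_slab unfolding slab_def mem_Collect_eq ip L2_set_restrict by blast+
        then have ge: "0 \<le> inner_on d u y" and "inner_on d u y \<le> \<eta>" by (auto simp: algebra_simps)
        moreover have "L2_set y {..<d} \<le> s"
        proof -
          \<comment> \<open>In the squared norm of the shifted point both the cross term and
            \<open>?a\<^sup>2\<close> are nonnegative, so undoing the shift does not lengthen
            \<open>y\<close>.\<close>
          have "0 \<le> 2 * ?a * inner_on d u y" using ge \<open>\<eta> > 0\<close> by simp
          then have "(L2_set y {..<d})\<^sup>2 \<le> (L2_set (\<lambda>i. ?a * u i + y i) {..<d})\<^sup>2"
            unfolding L2_set_add_scaled[OF u] by simp
          then have "L2_set y {..<d} \<le> L2_set (\<lambda>i. ?a * u i + y i) {..<d}"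
            by (rule power2_le_imp_le) simp
          then show ?thesis using s by linarith
        qed
        ultimately show "y \<in> slab 0 \<eta>" using y by (simp add: slab_def)
      qed
    qed measurable
    finally show ?thesis .
  qed
  have ip_le: "\<bar>inner_on d u y\<bar> \<le> s" if "L2_set y {..<d} \<le> s" for y
  proof -
    have "inner_on d u (\<lambda>i. - y i) \<le> L2_set u {..<d} * L2_set (\<lambda>i. - y i) {..<d}"
      by (rule inner_on_le_L2_set)
    moreover have "L2_set (\<lambda>i. - y i) {..<d} = L2_set y {..<d}" by (simp add: L2_set_def)
    ultimately show ?thesis using inner_on_le_L2_set[of u y d] u that by (simp add: sum_negf abs_le_iff)
  qed
  \<comment> \<open>Levels in the half ball are at most \<open>s < K * \<eta>\<close>, so
    \<open>K\<close> slabs of thickness \<open>\<eta>\<close> cover it, none larger than the central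
    one.\<close>
  have half: "emeasure (volume d) (slab 0 s) \<le> of_nat K * emeasure (volume d) (slab 0 \<eta>)"
  proof -
    have "slab 0 s \<subseteq> (\<Union>k<K. slab (real k * \<eta>) (real (Suc k) * \<eta>))"
    proof
      fix y assume y: "y \<in> slab 0 s"
      define q where "q = inner_on d u y / \<eta>"
      define k where "k = nat \<lfloor>q\<rfloor>"
      have q: "q \<ge> 0" "inner_on d u y = q * \<eta>" using y \<open>\<eta> > 0\<close> by (auto simp: q_def slab_def)
      then have k: "real k \<le> q" "q \<le> real (Suc k)" unfolding k_def by linarith+
      have "q * \<eta> < real K * \<eta>" using y K q(2) by (auto simp: slab_def)
      then have "k < K" using k(1) \<open>\<eta> > 0\<close> by simp
      moreover have "real k * \<eta> \<le> q * \<eta>" "q * \<eta> \<le> real (Suc k) * \<eta>"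
        using k \<open>\<eta> > 0\<close> by (auto intro!: mult_right_mono)
      ultimately show "y \<in> (\<Union>k<K. slab (real k * \<eta>) (real (Suc k) * \<eta>))"
        using y unfolding slab_def mem_Collect_eq UN_iff lessThan_iff q(2) by blast
    qed
    then have "emeasure (volume d) (slab 0 s) \<le> emeasure (volume d) (\<Union>k<K. slab (real k * \<eta>) (real (Suc k) * \<eta>))"
      by (intro emeasure_mono) auto
    also have "\<dots> \<le> (\<Sum>k<K. emeasure (volume d) (slab (real k * \<eta>) (real (Suc k) * \<eta>)))"
      by (intro emeasure_subadditive_finite) auto
    also have "\<dots> \<le> (\<Sum>k<K. emeasure (volume d) (slab 0 \<eta>))"
      by (intro sum_mono central)
    finally show ?thesis by simp
  qed
  \<comment> \<open>The reflection in the origin exchanges the two half balls; this is the 2 in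
    \<open>2 * K\<close>.\<close>
  have refl: "emeasure (volume d) (slab (-s) 0) = emeasure (volume d) (slab 0 s)"
  proof -
    have "emeasure (volume d) (slab (-s) 0) = ennreal (\<bar>-1\<bar> ^ d) *
        emeasure (volume d) {y \<in> points d. (\<lambda>i\<in>{..<d}. 0 + (-1) * y i) \<in> slab (-s) 0}"
      by (rule emeasure_volume_affine) auto
    also have "{y \<in> points d. (\<lambda>i\<in>{..<d}. 0 + (-1) * y i) \<in> slab (-s) 0} = slab 0 s"
    proof -
      have "L2_set (\<lambda>i. - y i) {..<d} = L2_set y {..<d}" for y by (simp add: L2_set_def)
      moreover have "inner_on d u (\<lambda>i\<in>{..<d}. - y i) = - inner_on d u y" for y
        unfolding sum_negf[symmetric] by (intro sum.cong) auto
      ultimately have "(\<lambda>i\<in>{..<d}. 0 + (-1) * y i) \<in> slab (-s) 0 \<longleftrightarrow>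
          L2_set y {..<d} \<le> s \<and> 0 \<le> inner_on d u y \<and> inner_on d u y \<le> s" for y
        by (simp add: slab_def conj_commute)
      then show ?thesis unfolding slab_def by blast
    qed
    finally show ?thesis by simp
  qed
  have "ennreal (s ^ d) * emeasure (volume d) (unit_ball d) = emeasure (volume d) {y \<in> points d. L2_set y {..<d} \<le> s}"
    using emeasure_volume_ball[OF \<open>s > 0\<close>, of d "\<lambda>_. 0"] by simp
  also have "{y \<in> points d. L2_set y {..<d} \<le> s} \<subseteq> slab (-s) 0 \<union> slab 0 s"
  proof
    fix y assume y: "y \<in> {y \<in> points d. L2_set y {..<d} \<le> s}"
    then have "\<bar>inner_on d u y\<bar> \<le> s" using ip_le by blast
    then have "- s \<le> inner_on d u y \<and> inner_on d u y \<le> 0 \<or> 0 \<le> inner_on d u y \<and> inner_on d u y \<le> s"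
      by linarith
    then show "y \<in> slab (-s) 0 \<union> slab 0 s" using y unfolding slab_def by blast
  qed
  then have "emeasure (volume d) {y \<in> points d. L2_set y {..<d} \<le> s}
      \<le> emeasure (volume d) (slab (-s) 0 \<union> slab 0 s)"
    by (intro emeasure_mono) auto
  also have "\<dots> \<le> emeasure (volume d) (slab (-s) 0) + emeasure (volume d) (slab 0 s)"
    by (intro emeasure_subadditive) auto
  also have "\<dots> \<le> of_nat K * emeasure (volume d) (slab 0 \<eta>) + of_nat K * emeasure (volume d) (slab 0 \<eta>)"
    unfolding refl by (intro add_mono half)
  also have "\<dots> = of_nat (2 * K) * emeasure (volume d) (slab 0 \<eta>)"
    by (simp add: mult_2 distrib_right)
  finally show ?thesis by (simp only: slab_def)
qed

lemma sets_cap [measurable]: "{y \<in> unit_ball d. t \<le> inner_on d u y} \<in> sets (volume d)"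
proof -
  have "{y \<in> space (volume d). L2_set y {..<d} \<le> 1 \<and> t \<le> inner_on d u y} \<in> sets (volume d)"
    by measurable
  also have "{y \<in> space (volume d). L2_set y {..<d} \<le> 1 \<and> t \<le> inner_on d u y}
      = {y \<in> unit_ball d. t \<le> inner_on d u y}"
    by (simp add: unit_ball_def conj_assoc)
  finally show ?thesis .
qed

text \<open>Shifting the central slab by \<open>\<tau>\<close> along \<open>u\<close> lands in the
  cap, since the squared norm becomes at most
  \<open>s\<^sup>2 + 2 * \<tau> * \<eta> + \<tau>\<^sup>2\<close>. A shifted half ball would have a
  cross term up to \<open>2 * \<tau> * s\<close>, of order \<open>1 / sqrt d\<close> in the
  application, where only order \<open>1 / d\<close> is available. The thin slab avoids this at the
  price of the factor \<open>2 * K\<close>.\<close>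

lemma cap_volume_unit:
  assumes u: "L2_set u {..<d} = 1" and "s > 0" "\<eta> > 0" "s < real K * \<eta>"
    and \<tau>: "0 \<le> \<tau>" "s\<^sup>2 + 2 * \<tau> * \<eta> + \<tau>\<^sup>2 \<le> 1"
  shows "ennreal (s ^ d) * emeasure (volume d) (unit_ball d)
           \<le> of_nat (2 * K) * emeasure (volume d) {y \<in> unit_ball d. \<tau> \<le> inner_on d u y}"
proof -
  let ?slab = "{y \<in> points d. L2_set y {..<d} \<le> s \<and> 0 \<le> inner_on d u y \<and> inner_on d u y \<le> \<eta>}"
  let ?cap = "{y \<in> unit_ball d. \<tau> \<le> inner_on d u y}"
  let ?T = "{y \<in> points d. (\<lambda>i\<in>{..<d}. \<tau> * u i + y i) \<in> ?cap}"
  have "?slab \<subseteq> ?T"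
  proof safe
    fix y assume y: "y \<in> points d" "L2_set y {..<d} \<le> s" "0 \<le> inner_on d u y" "inner_on d u y \<le> \<eta>"
    have "inner_on d u (\<lambda>i\<in>{..<d}. \<tau> * u i + y i) = inner_on d u (\<lambda>i. \<tau> * u i + y i)"
      by (intro sum.cong) auto
    then show "\<tau> \<le> inner_on d u (\<lambda>i\<in>{..<d}. \<tau> * u i + y i)"
      using inner_on_add_scaled[OF u] y by simp
    have "(L2_set y {..<d})\<^sup>2 \<le> s\<^sup>2" using y by (intro power_mono) auto
    moreover have "2 * \<tau> * inner_on d u y \<le> 2 * \<tau> * \<eta>" using y \<tau> by (intro mult_left_mono) auto
    ultimately have "(L2_set (\<lambda>i. \<tau> * u i + y i) {..<d})\<^sup>2 \<le> 1\<^sup>2"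
      unfolding L2_set_add_scaled[OF u] using \<tau> by simp
    then have "L2_set (\<lambda>i. \<tau> * u i + y i) {..<d} \<le> 1" by (rule power2_le_imp_le) simp
    then show "(\<lambda>i\<in>{..<d}. \<tau> * u i + y i) \<in> unit_ball d" by (simp add: unit_ball_def)
  qed
  moreover have "?T \<in> sets (volume d)"
  proof -
    have "(\<lambda>y. \<lambda>i\<in>{..<d}. \<tau> * u i + y i) \<in> measurable (volume d) (volume d)"
      by (intro measurable_restrict) (auto intro!: borel_measurable_add measurable_coord)
    from measurable_sets[OF this sets_cap[of d \<tau> u]] show ?thesis
      by (simp add: vimage_def Int_def conj_commute)
  qed
  ultimately have "emeasure (volume d) ?slab \<le> emeasure (volume d) ?T"
    by (rule emeasure_mono)
  also have "\<dots> = emeasure (volume d) ?cap"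
    by (rule emeasure_volume_translate[symmetric]) measurable
  finally have "of_nat (2 * K) * emeasure (volume d) ?slab \<le> of_nat (2 * K) * emeasure (volume d) ?cap"
    by (rule mult_left_mono) simp
  with central_slab_volume[OF assms(1-4)] show ?thesis by (rule order_trans)
qed

text \<open>Grid vectors are only approximately normalised. Dividing \<open>u\<close> by its norm
  reduces to a unit normal at height \<open>\<tau>\<close>, and
  \<open>t \<le> \<tau> * L2_set u {..<d}\<close> makes that cap part of the one at level
  \<open>t\<close>.\<close>

lemma measure_cap_ge:
  assumes u: "L2_set u {..<d} > 0" "t \<le> \<tau> * L2_set u {..<d}"
    and "s > 0" "\<eta> > 0" and K: "s < real K * \<eta>"
    and "0 \<le> \<tau>" "s\<^sup>2 + 2 * \<tau> * \<eta> + \<tau>\<^sup>2 \<le> 1"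
  shows "s ^ d / (2 * real K) \<le> measure (unif_ball d) {y \<in> unit_ball d. t \<le> inner_on d u y}"
proof -
  interpret prob_space "unif_ball d" by (rule prob_space_unif_ball)
  define \<nu> where "\<nu> = L2_set u {..<d}"
  define v where "v = (\<lambda>i. 1 / \<nu> * u i)"
  let ?cap = "{y \<in> unit_ball d. t \<le> inner_on d u y}"
  let ?V = "emeasure (volume d) (unit_ball d)"
  have "\<nu> > 0" using u by (simp add: \<nu>_def)
  have v: "L2_set v {..<d} = 1"
    unfolding v_def using \<open>\<nu> > 0\<close>
    by (subst L2_set_right_distrib[symmetric]) (auto simp: \<nu>_def)
  have ip: "inner_on d u y = \<nu> * inner_on d v y" for y
    unfolding v_def sum_distrib_left using \<open>\<nu> > 0\<close> by (intro sum.cong) auto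
  have "{y \<in> unit_ball d. \<tau> \<le> inner_on d v y} \<subseteq> ?cap"
  proof safe
    fix y assume "\<tau> \<le> inner_on d v y"
    then have "\<nu> * \<tau> \<le> \<nu> * inner_on d v y" using \<open>\<nu> > 0\<close> by (intro mult_left_mono) auto
    also have "\<dots> = inner_on d u y" by (rule ip[symmetric])
    finally show "t \<le> inner_on d u y" using u(2) by (simp add: \<nu>_def mult.commute)
  qed
  then have "emeasure (volume d) {y \<in> unit_ball d. \<tau> \<le> inner_on d v y} \<le> emeasure (volume d) ?cap"
    by (intro emeasure_mono) auto
  then have "of_nat (2 * K) * emeasure (volume d) {y \<in> unit_ball d. \<tau> \<le> inner_on d v y}
      \<le> of_nat (2 * K) * emeasure (volume d) ?cap"
    by (rule mult_left_mono) simp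
  with cap_volume_unit[OF v assms(3-)]
  have "ennreal (s ^ d) * ?V \<le> of_nat (2 * K) * emeasure (volume d) ?cap"
    by (rule order_trans)
  then have "ennreal (s ^ d) * ?V / ?V \<le> of_nat (2 * K) * emeasure (volume d) ?cap / ?V"
    by (rule divide_right_mono_ennreal)
  also have "\<dots> = of_nat (2 * K) * (emeasure (volume d) ?cap / ?V)"
    by (simp add: ennreal_times_divide)
  also have "emeasure (volume d) ?cap / ?V = emeasure (unif_ball d) ?cap"
  proof -
    have "unit_ball d \<inter> ?cap = ?cap" by blast
    then show ?thesis by (simp add: emeasure_unif_ball)
  qed
  also have "\<dots> = ennreal (measure (unif_ball d) ?cap)" by (simp add: emeasure_eq_measure)
  also have "ennreal (s ^ d) * ?V / ?V = ennreal (s ^ d)"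
    using emeasure_unit_ball[of d] by (simp add: ennreal_mult_divide_eq)
  also have "of_nat (2 * K) * ennreal (measure (unif_ball d) ?cap) = ennreal (real (2 * K) * measure (unif_ball d) ?cap)"
    by (subst ennreal_mult) (auto simp: ennreal_of_nat_eq_real_of_nat)
  finally have "s ^ d \<le> real (2 * K) * measure (unif_ball d) ?cap"
    by (subst (asm) ennreal_le_iff) auto
  moreover have "real K > 0"
  proof (rule ccontr)
    assume "\<not> real K > 0"
    then have "real K = 0" by simp
    then show False using K \<open>s > 0\<close> by simp
  qed
  ultimately show ?thesis by (simp add: field_simps)
qed

section \<open>Empty caps and isolated points\<close>

text \<open>A finite family of normals chosen independently of the sample. Entries in
  \<open>[-1, 1]\<close> suffice to approximate unit vectors; the grid vectors themselves are not
  normalised.\<close>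

definition grid :: "nat \<Rightarrow> nat \<Rightarrow> (nat \<Rightarrow> real) set" where
  "grid d m = {..<d} \<rightarrow>\<^sub>E (\<lambda>k. real_of_int k / real m) ` {- int m..int m}"

lemma finite_grid: "finite (grid d m)"
  unfolding grid_def by (intro finite_PiE) auto

lemma card_grid_le: "card (grid d m) \<le> (2 * m + 1) ^ d"
proof -
  have "card (grid d m) = card ((\<lambda>k. real_of_int k / real m) ` {- int m..int m}) ^ d"
    unfolding grid_def by (subst card_PiE) (auto simp: prod_constant)
  also have "card ((\<lambda>k. real_of_int k / real m) ` {- int m..int m}) \<le> card {- int m..int m}"
    by (rule card_image_le) simp
  then have "card ((\<lambda>k. real_of_int k / real m) ` {- int m..int m}) ^ d \<le> card {- int m..int m} ^ d"
    by (rule power_mono) simp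
  also have "card {- int m..int m} = 2 * m + 1" by simp
  finally show ?thesis .
qed

text \<open>Rounding each coordinate down costs at most \<open>1 / m\<close>, and the Euclidean norm
  of the error is bounded by the sum of its \<open>d\<close> entries.\<close>

lemma grid_approx:
  assumes w: "L2_set w {..<d} = 1" and m: "m > 0"
  obtains u where "u \<in> grid d m" "L2_set (\<lambda>i. u i - w i) {..<d} \<le> real d / real m"
proof
  let ?u = "\<lambda>i\<in>{..<d}. real_of_int \<lfloor>real m * w i\<rfloor> / real m"
  show "?u \<in> grid d m"
    unfolding grid_def
  proof (intro restrict_PiE_iff[THEN iffD2] ballI imageI)
    fix i assume "i \<in> {..<d}"
    have "\<bar>w i\<bar> = sqrt ((w i)\<^sup>2)" by simp
    also have "\<dots> \<le> L2_set w {..<d}"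
      unfolding L2_set_def using \<open>i \<in> {..<d}\<close> by (intro real_sqrt_le_mono member_le_sum) auto
    finally have "\<bar>w i\<bar> \<le> 1" using w by simp
    then have "real m * \<bar>w i\<bar> \<le> real m * 1" by (intro mult_left_mono) auto
    then have "\<bar>real m * w i\<bar> \<le> real m" by (simp add: abs_mult)
    then show "\<lfloor>real m * w i\<rfloor> \<in> {- int m..int m}" by (simp add: floor_le_iff le_floor_iff) linarith
  qed
  have "\<bar>?u i - w i\<bar> \<le> 1 / real m" if "i < d" for i
  proof -
    have "\<bar>real_of_int \<lfloor>real m * w i\<rfloor> - real m * w i\<bar> \<le> 1" by linarith
    then have "\<bar>real_of_int \<lfloor>real m * w i\<rfloor> - real m * w i\<bar> / real m \<le> 1 / real m"
      by (rule divide_right_mono) simp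
    also have "\<bar>real_of_int \<lfloor>real m * w i\<rfloor> - real m * w i\<bar> / real m
        = \<bar>(real_of_int \<lfloor>real m * w i\<rfloor> - real m * w i) / real m\<bar>" by simp
    also have "(real_of_int \<lfloor>real m * w i\<rfloor> - real m * w i) / real m = ?u i - w i"
      using that m by (simp add: diff_divide_distrib)
    finally show ?thesis .
  qed
  then have "(\<Sum>i<d. \<bar>?u i - w i\<bar>) \<le> (\<Sum>i<d. 1 / real m)" by (intro sum_mono) auto
  then show "L2_set (\<lambda>i. ?u i - w i) {..<d} \<le> real d / real m"
    using L2_set_le_sum_abs[of "\<lambda>i. ?u i - w i" "{..<d}"] by simp
qed

section \<open>Geometric criteria for vertices\<close>

lemma L2_set_minus: "L2_set (\<lambda>i. - f i) A = L2_set f A"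
  by (simp add: L2_set_def)

text \<open>Separate \<open>v\<close> from the other points and normalise. The normal is nonzero
  because it distinguishes \<open>v\<close> strictly from a second point.\<close>

lemma extreme_point_supporting_unit:
  assumes S: "finite S" "S \<subseteq> points d" and v: "v extreme_point_of (convex hull S)" and d: "d > 0"
  obtains w where "L2_set w {..<d} = 1" "\<And>y. y \<in> S \<Longrightarrow> inner_on d w y \<le> inner_on d w v"
proof (cases "S \<subseteq> {v}")
  case True
  \<comment> \<open>Without a second point separation might return the zero vector; the first basis
    vector serves instead and exists because \<open>d > 0\<close>.\<close>
  have "L2_set (\<lambda>i. if i = 0 then 1 else 0) {..<d} = 1"
    using d unfolding L2_set_def by (subst sum.remove[of _ 0]) auto
  then show ?thesis using that True by blast
next
  case False
  from S have "finite (S - {v})" "S - {v} \<subseteq> points d" "v \<in> points d"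
    using extreme_point_convex_hullD(1)[OF v] by auto
  from this extreme_point_convex_hullD(2)[OF v]
  obtain w where w: "\<And>y. y \<in> S - {v} \<Longrightarrow> inner_on d w y < inner_on d w v"
    by (rule separate_point_convex_hull) blast
  from False obtain y0 where "y0 \<in> S - {v}" by blast
  then have *: "inner_on d w y0 < inner_on d w v" by (rule w)
  define \<nu> where "\<nu> = L2_set w {..<d}"
  have "\<nu> \<noteq> 0"
  proof
    assume "\<nu> = 0"
    then have "w i = 0" if "i < d" for i using that by (simp add: \<nu>_def L2_set_eq_0_iff)
    then have "inner_on d w y = 0" for y by (intro sum.neutral) auto
    with * show False by simp
  qed
  then have \<nu>: "\<nu> > 0" by (simp add: \<nu>_def order_less_le)
  have "L2_set (\<lambda>i. 1 / \<nu> * w i) {..<d} = 1"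
    using \<nu> by (subst L2_set_right_distrib[symmetric]) (auto simp: \<nu>_def)
  moreover have "inner_on d (\<lambda>i. 1 / \<nu> * w i) y \<le> inner_on d (\<lambda>i. 1 / \<nu> * w i) v" if "y \<in> S" for y
  proof -
    have "inner_on d w y \<le> inner_on d w v"
      using w[of y] that by (cases "y = v") auto
    then have "1 / \<nu> * inner_on d w y \<le> 1 / \<nu> * inner_on d w v"
      using \<nu> by (intro mult_left_mono) auto
    then show ?thesis by (simp add: sum_distrib_left mult.assoc)
  qed
  ultimately show ?thesis using that by blast
qed

text \<open>A unit normal \<open>w\<close> supporting the hull at \<open>v\<close> satisfies
  \<open>inner_on d w y \<le> L2_set v {..<d} \<le> \<rho>\<close> for every \<open>y\<close> in
  \<open>S\<close>. Passing to a grid vector \<open>u\<close> within \<open>\<delta>\<close> of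
  \<open>w\<close> changes the functional by at most \<open>\<delta>\<close> on the unit ball, so no
  point of \<open>S\<close> in that ball reaches level \<open>t\<close>.\<close>

lemma extreme_point_empty_cap:
  assumes S: "finite S" "S \<subseteq> points d" and v: "v extreme_point_of (convex hull S)" and "d > 0"
    and norm: "L2_set v {..<d} \<le> \<rho>" and m: "m > 0" "real d / real m \<le> \<delta>" and t: "\<rho> + \<delta> < t"
  obtains u where "u \<in> grid d m" "1 - \<delta> \<le> L2_set u {..<d}" "S \<inter> {y \<in> unit_ball d. t \<le> inner_on d u y} = {}"
proof -
  obtain w where w: "L2_set w {..<d} = 1" "\<And>y. y \<in> S \<Longrightarrow> inner_on d w y \<le> inner_on d w v"
    using extreme_point_supporting_unit[OF S v \<open>d > 0\<close>] by blast
  obtain u where u: "u \<in> grid d m" "L2_set (\<lambda>i. u i - w i) {..<d} \<le> real d / real m"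
    using grid_approx[OF w(1) m(1)] by blast
  then have diff: "L2_set (\<lambda>i. u i - w i) {..<d} \<le> \<delta>" using m(2) by linarith
  have "L2_set (\<lambda>i. u i + - (u i - w i)) {..<d} \<le> L2_set u {..<d} + L2_set (\<lambda>i. - (u i - w i)) {..<d}"
    by (rule L2_set_triangle_ineq)
  then have "1 - \<delta> \<le> L2_set u {..<d}"
    unfolding L2_set_minus using diff w(1) by simp
  moreover have "inner_on d u y < t" if y: "y \<in> S" "y \<in> unit_ball d" for y
  proof -
    have "inner_on d u y = inner_on d w y + inner_on d (\<lambda>i. u i - w i) y"
      unfolding sum.distrib[symmetric] by (intro sum.cong) (auto simp: algebra_simps)
    moreover have "inner_on d w y \<le> \<rho>"
      using w(2)[OF y(1)] inner_on_le_L2_set[of w v d] norm w(1) by simp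
    moreover have "inner_on d (\<lambda>i. u i - w i) y \<le> L2_set (\<lambda>i. u i - w i) {..<d} * L2_set y {..<d}"
      by (rule inner_on_le_L2_set)
    moreover have "L2_set (\<lambda>i. u i - w i) {..<d} * L2_set y {..<d} \<le> \<delta> * 1"
      using y diff by (intro mult_mono) (auto simp: unit_ball_def order_trans[OF L2_set_nonneg diff])
    ultimately show ?thesis using t by linarith
  qed
  ultimately show ?thesis using that u(1) by (force simp: disjoint_iff not_le)
qed

lemma far_points_extreme:
  \<comment> \<open>The functional with normal \<open>v\<close> works: twice
    \<open>inner_on d v y\<close> is \<open>|y|^2 + |v|^2 - |y - v|^2\<close>, at most
    \<open>|v|^2 + \<rho>\<^sup>2\<close>, which is less than \<open>2 * |v|^2\<close>.\<close>
  fixes v :: "nat \<Rightarrow> real"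
  assumes v: "v \<in> S" and ball: "\<And>y. y \<in> S \<Longrightarrow> L2_set y {..<d} \<le> 1"
    and norm: "0 \<le> \<rho>" "\<rho> < L2_set v {..<d}"
    and far: "\<And>y. y \<in> S \<Longrightarrow> y \<noteq> v \<Longrightarrow> 1 - \<rho>\<^sup>2 \<le> (L2_set (\<lambda>i. y i - v i) {..<d})\<^sup>2"
  shows "v extreme_point_of (convex hull S)"
proof (rule extreme_pointI_strict_max[OF v, where w = v and d = d])
  fix y assume y: "y \<in> S"
  show "y = v \<or> inner_on d v y < inner_on d v v"
  proof (cases "y = v")
    case False
    have "inner_on d (\<lambda>i. y i - v i) (\<lambda>i. y i - v i) = inner_on d y y + inner_on d v v - 2 * inner_on d v y"
      unfolding sum_distrib_left sum.distrib[symmetric] sum_subtractf[symmetric]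
      by (intro sum.cong) (auto simp: algebra_simps)
    then have "(L2_set (\<lambda>i. y i - v i) {..<d})\<^sup>2 = (L2_set y {..<d})\<^sup>2 + inner_on d v v - 2 * inner_on d v y"
      by (simp only: inner_on_self)
    moreover have "(L2_set y {..<d})\<^sup>2 \<le> 1" using ball[OF y] by (simp add: power_le_one)
    moreover have "\<rho>\<^sup>2 < inner_on d v v"
      unfolding inner_on_self using norm by (intro power_strict_mono) auto
    ultimately show ?thesis using far[OF y False] by linarith
  qed simp
qed

section \<open>The expected number of vertices\<close>

abbreviation sample :: "nat \<Rightarrow> nat \<Rightarrow> (nat \<Rightarrow> nat \<Rightarrow> real) measure" where
  "sample n d \<equiv> Pi\<^sub>M {..<n} (\<lambda>_. unif_ball d)"

abbreviation polytope_of :: "nat \<Rightarrow> (nat \<Rightarrow> nat \<Rightarrow> real) \<Rightarrow> (nat \<Rightarrow> real) set" where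
  "polytope_of n X \<equiv> convex hull (X ` {..<n})"

section \<open>Measurability of the vertex count\<close>

lemma product_prob_space_unif_ball: "product_prob_space (\<lambda>_. unif_ball d)"
  by (intro product_prob_spaceI prob_space_unif_ball)

lemma prob_space_sample: "prob_space (sample n d)"
  by (intro prob_space_PiM prob_space_unif_ball)

lemma sample_in_points: "X \<in> space (sample n d) \<Longrightarrow> j < n \<Longrightarrow> X j \<in> points d"
  by (auto simp: space_PiM)

lemma measurable_sample_component:
  "j < n \<Longrightarrow> f \<in> borel_measurable (volume d) \<Longrightarrow> (\<lambda>X. f (X j)) \<in> borel_measurable (sample n d)"
proof -
  assume j: "j < n" and f: "f \<in> borel_measurable (volume d)"
  have "f \<in> borel_measurable (unif_ball d)"
    using f measurable_cong_sets[OF sets_unif_ball refl] by blast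
  then show ?thesis
    using j by (intro measurable_compose[OF measurable_component_singleton]) auto
qed

text \<open>All points agree outside \<open>{..<d}\<close>, so equality is a finite conjunction of
  coordinate equations.\<close>

lemma measurable_sample_eq [measurable]:
  assumes "i < n" "j < n"
  shows "Measurable.pred (sample n d) (\<lambda>X. X j = X i)"
proof -
  have "Measurable.pred (sample n d) (\<lambda>X. \<forall>k\<in>{..<d}. X j k = X i k)"
  proof (rule pred_intros_finite)
    fix k assume "k \<in> {..<d}"
    then have "(\<lambda>X. X j k) \<in> borel_measurable (sample n d)"
      "(\<lambda>X. X i k) \<in> borel_measurable (sample n d)"
      using assms by (auto intro!: measurable_sample_component measurable_coord)
    then show "Measurable.pred (sample n d) (\<lambda>X. X j k = X i k)"
      unfolding order.eq_iff pred_def by (intro sets.sets_Collect_conj borel_measurable_le)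
  qed simp
  then show ?thesis
  proof (rule measurable_cong[THEN iffD1, rotated])
    fix X assume X: "X \<in> space (sample n d)"
    show "(\<forall>k\<in>{..<d}. X j k = X i k) = (X j = X i)"
      using sample_in_points[OF X assms(1)] sample_in_points[OF X assms(2)] by (metis PiE_ext)
  qed
qed

lemma measurable_extreme [measurable]:
  assumes i: "i < n"
  shows "Measurable.pred (sample n d) (\<lambda>X. X i extreme_point_of polytope_of n X)"
proof -
  obtain D :: "(nat \<Rightarrow> real) set" where D: "countable D"
      "\<And>U. open U \<Longrightarrow> U \<noteq> {} \<Longrightarrow> \<exists>w\<in>D. w \<in> U"
    using countable_dense_setE by blast
  have pred: "Measurable.pred (sample n d)
      (\<lambda>X. X j = X i \<or> inner_on d w (X j) < inner_on d w (X i))" if "j < n" for w j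
    using i that
    by (intro pred_intros_logic measurable_sample_eq borel_measurable_pred_less
        measurable_sample_component measurable_inner_on)
  have "{X \<in> space (sample n d). \<exists>w\<in>D. \<forall>j\<in>{..<n}. X j = X i \<or> inner_on d w (X j) < inner_on d w (X i)}
      \<in> sets (sample n d)"
    by (intro sets.sets_Collect_countable_Ex'[OF _ D(1)] sets.sets_Collect_finite_All
        pred[unfolded pred_def]) auto
  then have "Measurable.pred (sample n d) (\<lambda>X. \<exists>w\<in>D. \<forall>j\<in>{..<n}.
      X j = X i \<or> inner_on d w (X j) < inner_on d w (X i))"
    by (simp only: pred_def)
  then show ?thesis
  proof (rule measurable_cong[THEN iffD1, rotated])
    fix X assume X: "X \<in> space (sample n d)"
    have "X i extreme_point_of polytope_of n X \<longleftrightarrow>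
        (\<exists>w\<in>D. \<forall>y\<in>X ` {..<n}. y = X i \<or> inner_on d w y < inner_on d w (X i))"
    proof (rule extreme_point_iff_dense[OF D(2)])
      show "X ` {..<n} \<subseteq> points d" using sample_in_points[OF X] by blast
    qed (use i in auto)
    then show "(\<exists>w\<in>D. \<forall>j\<in>{..<n}. X j = X i \<or> inner_on d w (X j) < inner_on d w (X i))
        = (X i extreme_point_of polytope_of n X)"
      by simp
  qed
qed

text \<open>Each vertex is counted at the smallest index of a sample point equal to it.\<close>

lemma f0_polytope_of:
  "f0 (polytope_of n X) =
     (\<Sum>i<n. if X i extreme_point_of polytope_of n X \<and> (\<forall>j<i. X j \<noteq> X i) then 1 else 0)"
proof -
  let ?I = "{i\<in>{..<n}. X i extreme_point_of polytope_of n X \<and> (\<forall>j<i. X j \<noteq> X i)}"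
  have "{v. v extreme_point_of polytope_of n X} = X ` ?I"
  proof (intro equalityI subsetI)
    fix v assume v: "v \<in> {v. v extreme_point_of polytope_of n X}"
    define i where "i = (LEAST i. X i = v)"
    have "\<exists>i<n. X i = v" using extreme_point_of_convex_hull[of v "X ` {..<n}"] v by blast
    then obtain i0 where i0: "i0 < n" "X i0 = v" by blast
    have "X i = v" unfolding i_def by (rule LeastI[of _ i0]) (rule i0)
    moreover have "i \<le> i0" unfolding i_def by (rule Least_le) (rule i0)
    moreover have "\<forall>j<i. X j \<noteq> v" unfolding i_def using not_less_Least by blast
    ultimately show "v \<in> X ` ?I" using v i0 by force
  qed auto
  moreover have "inj_on X ?I"
    by (rule inj_onI) (metis (mono_tags, lifting) linorder_neqE_nat mem_Collect_eq)
  ultimately have "f0 (polytope_of n X) = card ?I"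
    by (simp add: f0_def card_image)
  also have "\<dots> = (\<Sum>i<n. if X i extreme_point_of polytope_of n X \<and> (\<forall>j<i. X j \<noteq> X i) then 1 else 0)"
    by (simp add: sum.If_cases Int_def)
  finally show ?thesis .
qed

lemma f0_le: "f0 (polytope_of n X) \<le> n"
proof -
  have "f0 (polytope_of n X) \<le> (\<Sum>i<n. 1)"
    unfolding f0_polytope_of by (intro sum_mono) auto
  then show ?thesis by simp
qed

lemma integrable_f0: "integrable (sample n d) (\<lambda>X. real (f0 (polytope_of n X)))"
proof -
  interpret prob_space "sample n d" by (rule prob_space_sample)
  show ?thesis
  proof (rule integrable_const_bound[of _ "real n"])
    have "Measurable.pred (sample n d) (\<lambda>X. X i extreme_point_of polytope_of n X \<and> (\<forall>j\<in>{..<i}. X j \<noteq> X i))"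
      if "i < n" for i
      using that by (intro pred_intros_logic pred_intros_finite measurable_extreme measurable_sample_eq) auto
    then have "Measurable.pred (sample n d) (\<lambda>X. X i extreme_point_of polytope_of n X \<and> (\<forall>j<i. X j \<noteq> X i))"
      if "i < n" for i
      using that by (simp add: Ball_def lessThan_iff)
    then show "(\<lambda>X. real (f0 (polytope_of n X))) \<in> borel_measurable (sample n d)"
      unfolding f0_polytope_of of_nat_sum if_distrib[of real]
      by (intro borel_measurable_sum measurable_If) (auto simp: pred_def)
  qed (simp add: f0_le)
qed

section \<open>Probabilities of outer points and empty caps\<close>

lemma (in prob_space)
  assumes "\<And>i. i \<in> I \<Longrightarrow> A i \<in> events"
  shows integrable_sum_indicator: "integrable M (\<lambda>x. \<Sum>i\<in>I. indicator (A i) x :: real)"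
    and expectation_sum_indicator: "expectation (\<lambda>x. \<Sum>i\<in>I. indicator (A i) x :: real) = (\<Sum>i\<in>I. prob (A i))"
proof -
  have int: "integrable M (\<lambda>x. indicator (A i) x :: real)" if "i \<in> I" for i
    using assms[OF that] by (simp add: emeasure_eq_measure)
  then show "integrable M (\<lambda>x. \<Sum>i\<in>I. indicator (A i) x :: real)"
    by (rule Bochner_Integration.integrable_sum)
  have "expectation (\<lambda>x. \<Sum>i\<in>I. indicator (A i) x :: real) = (\<Sum>i\<in>I. expectation (\<lambda>x. indicator (A i) x :: real))"
    using int by (rule Bochner_Integration.integral_sum)
  also have "\<dots> = (\<Sum>i\<in>I. prob (A i))"
    using assms by (intro sum.cong) (auto simp: sets.Int_space_eq2)
  finally show "expectation (\<lambda>x. \<Sum>i\<in>I. indicator (A i) x :: real) = (\<Sum>i\<in>I. prob (A i))" .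
qed

lemma sets_norm_gt: "{y \<in> points d. \<rho> < L2_set y {..<d}} \<in> sets (volume d)"
proof -
  have "{y \<in> space (volume d). \<rho> < L2_set y {..<d}} \<in> sets (volume d)" by measurable
  then show ?thesis by simp
qed

lemma sets_sample_component:
  assumes "i < n" "A \<in> sets (volume d)"
  shows "{X \<in> space (sample n d). X i \<in> A} \<in> sets (sample n d)"
proof -
  have "(\<lambda>X. X i) -` A \<inter> space (sample n d) \<in> sets (sample n d)"
    using assms by (intro measurable_sets[OF measurable_component_singleton]) auto
  then show ?thesis by (simp add: vimage_def Int_def conj_commute)
qed

lemma measure_sample_norm_gt:
  assumes "i < n" "0 < \<rho>" "\<rho> \<le> 1"
  shows "measure (sample n d) {X \<in> space (sample n d). X i \<in> {y \<in> points d. \<rho> < L2_set y {..<d}}} = 1 - \<rho> ^ d"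
proof -
  interpret U: prob_space "unif_ball d" by (rule prob_space_unif_ball)
  interpret product_prob_space "\<lambda>_::nat. unif_ball d" "{..<n}" by (rule product_prob_space_unif_ball)
  have compl: "{y \<in> points d. \<rho> < L2_set y {..<d}} = space (unif_ball d) - {y \<in> points d. L2_set y {..<d} \<le> \<rho>}"
    unfolding space_unif_ball by (intro set_eqI) (metis (no_types, lifting) Diff_iff linorder_not_le mem_Collect_eq)
  have "measure (sample n d) {X \<in> space (sample n d). X i \<in> {y \<in> points d. \<rho> < L2_set y {..<d}}}
      = measure (unif_ball d) {y \<in> points d. \<rho> < L2_set y {..<d}}"
    using assms(1) sets_norm_gt unfolding measure_def
    by (subst emeasure_PiM_Collect_single) auto
  also have "\<dots> = measure (unif_ball d) (space (unif_ball d) - {y \<in> points d. L2_set y {..<d} \<le> \<rho>})"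
    by (simp only: compl)
  also have "\<dots> = 1 - measure (unif_ball d) {y \<in> points d. L2_set y {..<d} \<le> \<rho>}"
  proof (rule U.prob_compl)
    have "{y \<in> space (volume d). L2_set y {..<d} \<le> \<rho>} \<in> sets (volume d)" by measurable
    then show "{y \<in> points d. L2_set y {..<d} \<le> \<rho>} \<in> U.events" by simp
  qed
  also have "\<dots> = 1 - \<rho> ^ d" unfolding measure_unif_ball_norm_le[OF assms(2,3)] ..
  finally show ?thesis .
qed

lemma measure_sample_avoid:
  assumes "A \<in> sets (volume d)"
  shows "measure (sample n d) {X \<in> space (sample n d). \<forall>j\<in>{..<n}. X j \<in> points d - A} = (1 - measure (unif_ball d) A) ^ n"
proof -
  interpret U: prob_space "unif_ball d" by (rule prob_space_unif_ball)
  interpret product_prob_space "\<lambda>_::nat. unif_ball d" "{..<n}" by (rule product_prob_space_unif_ball)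
  have "points d - A \<in> sets (unif_ball d)"
    using assms sets.compl_sets[of A "unif_ball d"] by simp
  then have "emeasure (sample n d) {X \<in> space (sample n d). \<forall>j\<in>{..<n}. X j \<in> points d - A}
      = (\<Prod>j<n. emeasure (unif_ball d) (points d - A))"
    by (intro emeasure_PiM_Collect) auto
  also have "\<dots> = ennreal (measure (unif_ball d) (points d - A)) ^ n"
    by (simp add: U.emeasure_eq_measure)
  also have "measure (unif_ball d) (points d - A) = 1 - measure (unif_ball d) A"
    using U.prob_compl[of A] assms by simp
  finally show ?thesis
    unfolding measure_def[of "sample n d"] using U.prob_le_1[of A] by (simp add: ennreal_power)
qed

text \<open>Pointwise, \<open>f0\<close> is at most the number of sample points of norm above
  \<open>\<rho>\<close> plus \<open>n\<close> times the number of normals in \<open>G\<close> whose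
  cap is empty. One empty cap makes this trivial because \<open>f0\<close> is at most
  \<open>n\<close>; without one, every vertex has norm above \<open>\<rho>\<close>. By independence
  a cap is empty with probability at most \<open>(1 - p) ^ n\<close>.\<close>

lemma expected_f0_le:
  assumes d: "d > 0" and \<rho>: "0 < \<rho>" "\<rho> \<le> 1"
    and m: "m > 0" "real d / real m \<le> \<delta>" "\<rho> + \<delta> < t"
    and cap: "\<And>u. 1 - \<delta> \<le> L2_set u {..<d} \<Longrightarrow> p \<le> measure (unif_ball d) {y \<in> unit_ball d. t \<le> inner_on d u y}"
  shows "expected_f0 n d \<le> real n * (1 - \<rho> ^ d + (2 * real m + 1) ^ d * (1 - p) ^ n)"
proof -
  interpret S: prob_space "sample n d" by (rule prob_space_sample)
  interpret U: prob_space "unif_ball d" by (rule prob_space_unif_ball)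
  define cap where "cap = (\<lambda>u. {y \<in> unit_ball d. t \<le> inner_on d u y})"
  define G where "G = {u \<in> grid d m. 1 - \<delta> \<le> L2_set u {..<d}}"
  define outer where "outer = (\<lambda>i. {X \<in> space (sample n d). X i \<in> {y \<in> points d. \<rho> < L2_set y {..<d}}})"
  define avoid where "avoid = (\<lambda>u. {X \<in> space (sample n d). \<forall>j\<in>{..<n}. X j \<in> points d - cap u})"
  have fG: "finite G" by (simp add: G_def finite_grid)
  have outer: "outer i \<in> S.events" if "i < n" for i
    unfolding outer_def by (intro sets_sample_component that sets_norm_gt)
  have avoid: "avoid u \<in> S.events" for u
  proof -
    have "points d - cap u \<in> sets (volume d)"
      using sets.compl_sets[OF sets_cap[of d t u]] by (simp add: cap_def)
    then show ?thesis
      unfolding avoid_def by (intro sets.sets_Collect_finite_All sets_sample_component) auto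
  qed
  have "(\<Sum>u\<in>G. measure (sample n d) (avoid u)) \<le> (\<Sum>u\<in>G. (1 - p) ^ n)"
  proof (rule sum_mono)
    fix u assume "u \<in> G"
    then have "p \<le> measure (unif_ball d) (cap u)" unfolding cap_def G_def by (intro cap) auto
    moreover have "cap u \<in> sets (volume d)" unfolding cap_def by measurable
    ultimately show "measure (sample n d) (avoid u) \<le> (1 - p) ^ n"
      unfolding avoid_def using U.prob_le_1[of "cap u"]
      by (subst measure_sample_avoid) (auto intro!: power_mono)
  qed
  also have "(\<Sum>u\<in>G. (1 - p) ^ n) \<le> (2 * real m + 1) ^ d * (1 - p) ^ n"
  proof -
    \<comment> \<open>Applying \<open>cap\<close> to the first basis vector bounds \<open>p\<close>
      by a probability. Then \<open>(1 - p) ^ n\<close> is nonnegative and may multiply the bound on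
      \<open>card G\<close>.\<close>
    have "L2_set (\<lambda>i. if i = 0 then 1 else 0) {..<d} = 1"
      using d unfolding L2_set_def by (subst sum.remove[of _ 0]) auto
    moreover have "0 \<le> \<delta>" using m by (meson divide_nonneg_nonneg of_nat_0_le_iff order_trans)
    ultimately have "p \<le> 1"
      using cap[of "\<lambda>i. if i = 0 then 1 else 0"] U.prob_le_1 order_trans by fastforce
    moreover have "real (card G) \<le> (2 * real m + 1) ^ d"
    proof -
      have "card G \<le> card (grid d m)" by (intro card_mono finite_grid) (auto simp: G_def)
      then have "card G \<le> (2 * m + 1) ^ d" using card_grid_le order_trans by blast
      then have "real (card G) \<le> real ((2 * m + 1) ^ d)" by (rule of_nat_mono)
      then show ?thesis by (simp add: add.commute)
    qed
    ultimately show ?thesis by (simp add: mult_right_mono)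
  qed
  finally have avoid_le: "(\<Sum>u\<in>G. measure (sample n d) (avoid u)) \<le> (2 * real m + 1) ^ d * (1 - p) ^ n" .
  have "expected_f0 n d \<le> (\<integral>X. (\<Sum>i<n. indicator (outer i) X) + real n * (\<Sum>u\<in>G. indicator (avoid u) X) \<partial>sample n d)"
    unfolding expected_f0_def
  proof (rule integral_mono)
    show "integrable (sample n d) (\<lambda>X. (\<Sum>i<n. indicator (outer i) X) + real n * (\<Sum>u\<in>G. indicator (avoid u) X :: real))"
      using outer avoid
      by (intro Bochner_Integration.integrable_add integrable_mult_right S.integrable_sum_indicator) auto
    fix X assume X: "X \<in> space (sample n d)"
    let ?S = "X ` {..<n}"
    have S: "finite ?S" "?S \<subseteq> points d" using sample_in_points[OF X] by auto
    show "real (f0 (polytope_of n X)) \<le> (\<Sum>i<n. indicator (outer i) X) + real n * (\<Sum>u\<in>G. indicator (avoid u) X)"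
    proof (cases "\<exists>u\<in>G. X \<in> avoid u")
      case True
      then obtain u where u: "u \<in> G" "X \<in> avoid u" by blast
      have "real n * 1 \<le> real n * (\<Sum>u\<in>G. indicator (avoid u) X)"
      proof (rule mult_left_mono)
        have "(\<Sum>v\<in>{u}. indicator (avoid v) X :: real) \<le> (\<Sum>u\<in>G. indicator (avoid u) X)"
          using fG u by (intro sum_mono2) auto
        then show "1 \<le> (\<Sum>u\<in>G. indicator (avoid u) X :: real)" using u by simp
      qed simp
      moreover have "real (f0 (polytope_of n X)) \<le> real n" by (simp add: f0_le)
      moreover have "0 \<le> (\<Sum>i<n. indicator (outer i) X :: real)" by (intro sum_nonneg) auto
      ultimately show ?thesis by linarith
    next
      case False
      have ext: "X i extreme_point_of polytope_of n X \<Longrightarrow> X \<in> outer i" if "i < n" for i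
      proof (rule ccontr)
        assume ext: "X i extreme_point_of polytope_of n X" and "X \<notin> outer i"
        then have "L2_set (X i) {..<d} \<le> \<rho>"
          using X sample_in_points[OF X that] by (simp add: outer_def not_less)
        from extreme_point_empty_cap[OF S ext d this m]
        obtain u where u: "u \<in> grid d m" "1 - \<delta> \<le> L2_set u {..<d}" "?S \<inter> cap u = {}"
          unfolding cap_def by blast
        have "X \<in> avoid u"
          unfolding avoid_def using X S(2) u(3) by blast
        with u False show False by (simp add: G_def)
      qed
      have "f0 (polytope_of n X) \<le> (\<Sum>i<n. indicator (outer i) X :: nat)"
        unfolding f0_polytope_of using ext by (intro sum_mono) auto
      then have "real (f0 (polytope_of n X)) \<le> real (\<Sum>i<n. indicator (outer i) X)"
        by (rule of_nat_mono)
      also have "\<dots> = (\<Sum>i<n. indicator (outer i) X)" by (simp add: indicator_def)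
      finally show ?thesis by (simp add: add_increasing2 sum_nonneg)
    qed
  qed (rule integrable_f0)
  also have "\<dots> = (\<Sum>i<n. measure (sample n d) (outer i)) + real n * (\<Sum>u\<in>G. measure (sample n d) (avoid u))"
  proof -
    have I: "integrable (sample n d) (\<lambda>X. \<Sum>i<n. indicator (outer i) X :: real)"
      "integrable (sample n d) (\<lambda>X. \<Sum>u\<in>G. indicator (avoid u) X :: real)"
      using outer avoid by (auto intro!: S.integrable_sum_indicator)
    have "S.expectation (\<lambda>X. \<Sum>i<n. indicator (outer i) X) = (\<Sum>i<n. S.prob (outer i))"
      "S.expectation (\<lambda>X. \<Sum>u\<in>G. indicator (avoid u) X) = (\<Sum>u\<in>G. S.prob (avoid u))"
      by (rule S.expectation_sum_indicator; use outer avoid in auto)+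
    then show ?thesis
      unfolding Bochner_Integration.integral_add[OF I(1) integrable_mult_right[OF I(2)]] by simp
  qed
  also have "(\<Sum>i<n. measure (sample n d) (outer i)) = real n * (1 - \<rho> ^ d)"
    using measure_sample_norm_gt[OF _ \<rho>] by (simp add: outer_def)
  also have "real n * (1 - \<rho> ^ d) + real n * (\<Sum>u\<in>G. measure (sample n d) (avoid u))
      \<le> real n * (1 - \<rho> ^ d) + real n * ((2 * real m + 1) ^ d * (1 - p) ^ n)"
    by (intro add_left_mono mult_left_mono avoid_le) simp
  finally show ?thesis by (simp add: algebra_simps)
qed

section \<open>Pairs of close points and the lower bound\<close>

lemma sets_sample_close:
  assumes "i < n" "j < n"
  shows "{X \<in> space (sample n d). L2_set (\<lambda>k. X j k - X i k) {..<d} \<le> s} \<in> sets (sample n d)"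
proof -
  have "(\<lambda>X. \<Sum>k<d. (X j k - X i k)\<^sup>2) \<in> borel_measurable (sample n d)"
    using assms by (intro borel_measurable_sum borel_measurable_power borel_measurable_diff
        measurable_sample_component measurable_coord) auto
  then have "(\<lambda>X. sqrt (\<Sum>k<d. (X j k - X i k)\<^sup>2)) \<in> borel_measurable (sample n d)"
    by (rule measurable_compose[OF _ borel_measurable_sqrt])
  then show ?thesis
    unfolding L2_set_def by (intro borel_measurable_le borel_measurable_const)
qed

text \<open>Fubini: with all points except \<open>X j\<close> fixed, \<open>X j\<close> has to fall
  into the ball of radius \<open>s\<close> around the fixed point \<open>X i\<close>.\<close>

lemma measure_sample_close_le:
  assumes ij: "i < n" "j < n" "i \<noteq> j" and s: "s > 0"
  shows "measure (sample n d) {X \<in> space (sample n d). L2_set (\<lambda>k. X j k - X i k) {..<d} \<le> s} \<le> s ^ d"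
proof -
  interpret S: prob_space "sample n d" by (rule prob_space_sample)
  interpret product_prob_space "\<lambda>_::nat. unif_ball d" "{..<n}" by (rule product_prob_space_unif_ball)
  let ?A = "{X \<in> space (sample n d). L2_set (\<lambda>k. X j k - X i k) {..<d} \<le> s}"
  let ?I = "{..<n} - {j}"
  interpret R: prob_space "Pi\<^sub>M ?I (\<lambda>_. unif_ball d)" by (intro prob_space_PiM prob_space_unif_ball)
  have ins: "insert j ?I = {..<n}" using ij by auto
  have "emeasure (sample n d) ?A = (\<integral>\<^sup>+ X. indicator ?A X \<partial>sample n d)"
    using sets_sample_close[OF ij(1,2)] by simp
  also have "\<dots> = (\<integral>\<^sup>+ X. (\<integral>\<^sup>+ y. indicator ?A (X(j := y)) \<partial>unif_ball d) \<partial>Pi\<^sub>M ?I (\<lambda>_. unif_ball d))"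
  proof -
    have "indicator ?A \<in> borel_measurable (Pi\<^sub>M (insert j ?I) (\<lambda>_. unif_ball d))"
      unfolding ins using sets_sample_close[OF ij(1,2)] by (rule borel_measurable_indicator)
    from product_nn_integral_insert[OF _ _ this] show ?thesis unfolding ins by simp
  qed
  also have "\<dots> \<le> (\<integral>\<^sup>+ X. ennreal (s ^ d) \<partial>Pi\<^sub>M ?I (\<lambda>_. unif_ball d))"
  proof (rule nn_integral_mono)
    fix X
    let ?B = "{y \<in> points d. L2_set (\<lambda>k. y k - X i k) {..<d} \<le> s}"
    have "{y \<in> space (volume d). L2_set (\<lambda>k. y k - X i k) {..<d} \<le> s} \<in> sets (volume d)" by measurable
    then have B: "?B \<in> sets (unif_ball d)" by simp
    have "(\<integral>\<^sup>+ y. indicator ?A (X(j := y)) \<partial>unif_ball d) \<le> (\<integral>\<^sup>+ y. indicator ?B y \<partial>unif_ball d)"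
    proof (rule nn_integral_mono)
      fix y assume y: "y \<in> space (unif_ball d)"
      have "(X(j := y)) \<in> ?A \<Longrightarrow> y \<in> ?B" using y ij(3) by simp
      then show "(indicator ?A (X(j := y)) :: ennreal) \<le> indicator ?B y"
        by (simp only: indicator_def split: if_splits) simp
    qed
    also have "\<dots> = emeasure (unif_ball d) ?B" using B by (rule nn_integral_indicator)
    also have "\<dots> \<le> ennreal (s ^ d)" using s by (rule emeasure_unif_ball_ball_le)
    finally show "(\<integral>\<^sup>+ y. indicator ?A (X(j := y)) \<partial>unif_ball d) \<le> ennreal (s ^ d)" .
  qed
  also have "\<dots> = ennreal (s ^ d)" by (simp only: nn_integral_const R.emeasure_space_1 mult_1_right)
  finally show ?thesis using s by (simp add: S.emeasure_eq_measure)
qed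

text \<open>Pointwise almost everywhere, \<open>f0\<close> is at least the number of outer points
  minus the number of ordered pairs at distance at most \<open>s\<close>: an outer point in no such
  pair is a vertex, and any other outer point is cancelled by a pair.\<close>

lemma expected_f0_ge:
  assumes \<rho>: "0 < \<rho>" "\<rho> < 1"
  shows "real n * (1 - \<rho> ^ d - real n * sqrt (1 - \<rho>\<^sup>2) ^ d) \<le> expected_f0 n d"
proof -
  interpret S: prob_space "sample n d" by (rule prob_space_sample)
  interpret product_prob_space "\<lambda>_::nat. unif_ball d" "{..<n}" by (rule product_prob_space_unif_ball)
  define s where "s = sqrt (1 - \<rho>\<^sup>2)"
  have s: "s > 0" "s\<^sup>2 = 1 - \<rho>\<^sup>2"
    using \<rho> by (auto simp: s_def power_less_one_iff abs_square_less_1 power_le_one)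
  define outer where "outer = (\<lambda>i. {X \<in> space (sample n d). X i \<in> {y \<in> points d. \<rho> < L2_set y {..<d}}})"
  define near where "near = (\<lambda>i j. {X \<in> space (sample n d). L2_set (\<lambda>k. X j k - X i k) {..<d} \<le> s})"
  have outer: "outer i \<in> S.events" if "i < n" for i
    unfolding outer_def by (intro sets_sample_component that sets_norm_gt)
  have near: "near i j \<in> S.events" if "i < n" "j < n" for i j
    unfolding near_def by (intro sets_sample_close that)
  let ?P = "Sigma {..<n} (\<lambda>i. {..<n} - {i})"
  let ?N = "\<lambda>X. \<Sum>p\<in>?P. indicator (near (fst p) (snd p)) X :: real"
  have N: "integrable (sample n d) ?N" "S.expectation ?N = (\<Sum>p\<in>?P. S.prob (near (fst p) (snd p)))"
    by (intro S.integrable_sum_indicator S.expectation_sum_indicator; auto intro: near)+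
  have I: "integrable (sample n d) (\<lambda>X. \<Sum>i<n. indicator (outer i) X :: real)"
    "S.expectation (\<lambda>X. \<Sum>i<n. indicator (outer i) X) = (\<Sum>i<n. S.prob (outer i))"
    by (intro S.integrable_sum_indicator S.expectation_sum_indicator; auto intro: outer)+
  have "real n * (1 - \<rho> ^ d - real n * s ^ d) \<le> real n * (1 - \<rho> ^ d) - (\<Sum>p\<in>?P. S.prob (near (fst p) (snd p)))"
  proof -
    have "(\<Sum>p\<in>?P. S.prob (near (fst p) (snd p))) \<le> (\<Sum>p\<in>?P. s ^ d)"
      using s by (intro sum_mono) (auto simp: near_def intro!: measure_sample_close_le)
    also have "\<dots> = real (card ?P) * s ^ d" by simp
    also have "\<dots> \<le> real (n * n) * s ^ d"
    proof (intro mult_right_mono of_nat_mono)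
      have "card ?P \<le> card ({..<n} \<times> {..<n})" by (intro card_mono) auto
      then show "card ?P \<le> n * n" by simp
    qed (use s in simp)
    finally show ?thesis by (simp add: algebra_simps)
  qed
  also have "real n * (1 - \<rho> ^ d) = (\<Sum>i<n. S.prob (outer i))"
    using measure_sample_norm_gt[of _ n \<rho> d] \<rho> by (simp add: outer_def)
  also have "\<dots> - (\<Sum>p\<in>?P. S.prob (near (fst p) (snd p)))
      = S.expectation (\<lambda>X. (\<Sum>i<n. indicator (outer i) X) - ?N X)"
    unfolding Bochner_Integration.integral_diff[OF I(1) N(1)] I(2) N(2) ..
  also have "\<dots> \<le> expected_f0 n d"
    unfolding expected_f0_def
  proof (rule integral_mono_AE)
    \<comment> \<open>\<open>unif_ball d\<close> lives on all of \<open>points d\<close>, so the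
      sample lies in the unit ball only almost surely.\<close>
    have "AE X in sample n d. \<forall>j\<in>{..<n}. L2_set (X j) {..<d} \<le> 1"
      using AE_component[OF _ AE_unif_ball] by (intro AE_finite_allI) auto
    moreover have "AE X in sample n d. X \<in> space (sample n d)" by (rule AE_space)
    ultimately show "AE X in sample n d. (\<Sum>i<n. indicator (outer i) X) - ?N X \<le> real (f0 (polytope_of n X))"
    proof eventually_elim
      fix X assume ball: "\<forall>j\<in>{..<n}. L2_set (X j) {..<d} \<le> 1" and X: "X \<in> space (sample n d)"
      let ?isolated = "\<lambda>i. X \<in> outer i \<and> (\<forall>j<n. j \<noteq> i \<longrightarrow> X \<notin> near i j)"
      have "(\<Sum>i<n. indicator (outer i) X) - ?N X
          = (\<Sum>i<n. indicator (outer i) X - (\<Sum>j\<in>{..<n} - {i}. indicator (near i j) X))"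
        by (simp add: sum.Sigma sum_subtractf case_prod_unfold)
      also have "\<dots> \<le> (\<Sum>i<n. real (if X i extreme_point_of polytope_of n X \<and> (\<forall>j<i. X j \<noteq> X i) then 1 else 0))"
      proof (rule sum_mono)
        fix i assume "i \<in> {..<n}"
        then have i: "i < n" by simp
        show "indicator (outer i) X - (\<Sum>j\<in>{..<n} - {i}. indicator (near i j) X)
            \<le> real (if X i extreme_point_of polytope_of n X \<and> (\<forall>j<i. X j \<noteq> X i) then 1 else 0)"
        proof (cases "?isolated i")
          case True
          \<comment> \<open>Distance above \<open>s > 0\<close> also rules out repeated points, so
            the vertex \<open>X i\<close> is counted at index \<open>i\<close> itself.\<close>
          have far: "s < L2_set (\<lambda>k. X j k - X i k) {..<d}" if "j < n" "j \<noteq> i" for j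
            using True that X by (simp add: near_def not_le)
          then have "X j \<noteq> X i" if "j < n" "j \<noteq> i" for j
            using far[OF that] s(1) by (auto simp: L2_set_def)
          moreover have "X i extreme_point_of polytope_of n X"
          proof (rule far_points_extreme)
            fix y assume "y \<in> X ` {..<n}" "y \<noteq> X i"
            then obtain j where j: "j < n" "j \<noteq> i" "y = X j" by blast
            have "s\<^sup>2 \<le> (L2_set (\<lambda>k. X j k - X i k) {..<d})\<^sup>2"
              using far[OF j(1,2)] s by (intro power_mono) auto
            then show "1 - \<rho>\<^sup>2 \<le> (L2_set (\<lambda>k. y k - X i k) {..<d})\<^sup>2"
              using j s by simp
          next
            show "\<rho> < L2_set (X i) {..<d}" using True by (simp add: outer_def)
          qed (use i \<rho> ball in auto)
          ultimately have "X i extreme_point_of polytope_of n X \<and> (\<forall>j<i. X j \<noteq> X i)"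
            using i by (metis less_trans less_irrefl)
          moreover have "0 \<le> (\<Sum>j\<in>{..<n} - {i}. indicator (near i j) X :: real)" by (intro sum_nonneg) auto
          ultimately show ?thesis by (simp add: indicator_def)
        next
          case False
          have nonneg: "0 \<le> (\<Sum>j\<in>{..<n} - {i}. indicator (near i j) X :: real)" by (intro sum_nonneg) auto
          have "indicator (outer i) X \<le> (\<Sum>j\<in>{..<n} - {i}. indicator (near i j) X :: real)"
          proof (cases "X \<in> outer i")
            case True
            with False obtain j where j: "j < n" "j \<noteq> i" "X \<in> near i j" by blast
            then have "(\<Sum>j\<in>{j}. indicator (near i j) X :: real) \<le> (\<Sum>j\<in>{..<n} - {i}. indicator (near i j) X)"
              by (intro sum_mono2) auto
            then show ?thesis using j True by simp
          qed (use nonneg in simp)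
          then show ?thesis by (simp add: add_increasing)
        qed
      qed
      also have "\<dots> = real (f0 (polytope_of n X))" by (simp only: f0_polytope_of of_nat_sum)
      finally show "(\<Sum>i<n. indicator (outer i) X) - ?N X \<le> real (f0 (polytope_of n X))" .
    qed
  qed (intro Bochner_Integration.integrable_diff I N integrable_f0)+
  finally show ?thesis by (simp only: s_def)
qed

section \<open>Asymptotics\<close>

lemma eventually_real_gt: "eventually (\<lambda>d. c < real d) sequentially"
  using filterlim_real_sequentially by (simp add: filterlim_at_top_dense)

text \<open>Brings volumes into the form in which \<open>n\<close> is given. Positivity of
  \<open>d\<close> matters at \<open>s = 0\<close>, where \<open>0 ^ 0 = 1\<close> but
  \<open>0 powr 0 = 0\<close>.\<close>

lemma power_eq_powr_half:
  assumes "0 \<le> s" "d > 0"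
  shows "s ^ d = (s\<^sup>2) powr (real d / 2)"
proof (cases "s = 0")
  case False
  then have s: "s > 0" using assms by simp
  then have "s\<^sup>2 powr (real d / 2) = (s powr 2) powr (real d / 2)" by simp
  also have "\<dots> = s powr real d" by (simp only: powr_powr) simp
  also have "\<dots> = s ^ d" using s by (simp add: powr_realpow)
  finally show ?thesis by simp
qed (use assms in simp)

text \<open>With \<open>a = 2 * x + e d\<close> this is the expected number of points in a region of
  relative volume \<open>s ^ d\<close>: the growing factor \<open>d\<close> cancels and a geometric
  quantity remains, decided by whether \<open>2 * b / a\<close> is below or above 1.\<close>

lemma powr_half_mult_power:
  assumes "0 < a" "0 < b" "0 \<le> s" "s\<^sup>2 = 2 * b / real d" "d > 0"
  shows "(real d / a) powr (real d / 2) * s ^ d = (2 * b / a) powr (real d / 2)"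
proof -
  have "(real d / a) powr (real d / 2) * s ^ d = (real d / a * (2 * b / real d)) powr (real d / 2)"
    unfolding power_eq_powr_half[OF assms(3,5)] assms(4) by (rule powr_mult[symmetric])
  also have "real d / a * (2 * b / real d) = 2 * b / a" using assms by simp
  finally show ?thesis .
qed

lemma expected_f0_ratio_lower:
  fixes n :: "nat \<Rightarrow> nat"
  assumes x: "0 < y" "y < x" and e: "e \<longlonglongrightarrow> 0"
    and n: "\<And>d. d \<ge> 2 \<Longrightarrow> real (n d) = (real d / (2 * x + e d)) powr (real d / 2)"
    and a: "a < 1 - exp (- y)"
  shows "eventually (\<lambda>d. a < expected_f0 (n d) d / real (n d)) sequentially"
proof -
  \<comment> \<open>A fixed bound below 1 for \<open>2 * y / (2 * x + e d)\<close>, valid once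
    \<open>e d > y - x\<close>.\<close>
  define q where "q = 2 * y / (x + y)"
  have q: "0 < q" "q < 1" using x by (auto simp: q_def)
  have "(\<lambda>d. 1 - (1 + (- y) / real d) ^ d - q powr (real d / 2)) \<longlonglongrightarrow> 1 - exp (- y) - 0"
  proof (intro tendsto_diff tendsto_const tendsto_exp_limit_sequentially)
    show "(\<lambda>d. q powr (real d / 2)) \<longlonglongrightarrow> 0" using q by real_asymp
  qed
  then have lim: "eventually (\<lambda>d. a < 1 - (1 + (- y) / real d) ^ d - q powr (real d / 2)) sequentially"
    using a by (intro order_tendstoD) auto
  have e': "eventually (\<lambda>d. y - x < e d) sequentially" using e x by (intro order_tendstoD(1)[OF e]) auto
  show ?thesis
    using lim e' eventually_ge_at_top[of 2] eventually_real_gt[of y]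
  proof eventually_elim
    fix d assume lim: "a < 1 - (1 + (- y) / real d) ^ d - q powr (real d / 2)"
      and ed: "y - x < e d" and d: "2 \<le> d" "y < real d"
    let ?N = "real (n d)"
    define \<rho> where "\<rho> = 1 - y / real d"
    have \<rho>: "0 < \<rho>" "\<rho> < 1" using x d by (auto simp: \<rho>_def)
    \<comment> \<open>For small \<open>d\<close> the denominator in the formula for
      \<open>n d\<close> may fail to be positive; from here on it is positive, and so is
      \<open>n d\<close>.\<close>
    have pos: "2 * x + e d > x + y" using ed by simp
    then have N: "?N > 0" using d x by (simp add: n)
    define s where "s = sqrt (2 * y / real d)"
    have "sqrt (1 - \<rho>\<^sup>2) \<le> s"
      unfolding s_def
    proof (rule real_sqrt_le_mono)
      have "1 - \<rho>\<^sup>2 = 2 * y / real d - (y / real d)\<^sup>2"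
        by (simp add: \<rho>_def power2_diff)
      then show "1 - \<rho>\<^sup>2 \<le> 2 * y / real d" by simp
    qed
    moreover have "0 \<le> sqrt (1 - \<rho>\<^sup>2)" using \<rho> by (simp add: power_le_one)
    ultimately have "sqrt (1 - \<rho>\<^sup>2) ^ d \<le> s ^ d" by (rule power_mono)
    then have "?N * sqrt (1 - \<rho>\<^sup>2) ^ d \<le> ?N * s ^ d" by (intro mult_left_mono) auto
    also have "?N * s ^ d = (2 * y / (2 * x + e d)) powr (real d / 2)"
      unfolding n[OF d(1)] using x d pos by (intro powr_half_mult_power) (auto simp: s_def)
    also have "\<dots> \<le> q powr (real d / 2)"
    proof (intro powr_mono2)
      show "2 * y / (2 * x + e d) \<le> q" unfolding q_def using pos x by (intro divide_left_mono) auto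
    qed (use x pos in auto)
    finally have "a < 1 - \<rho> ^ d - ?N * sqrt (1 - \<rho>\<^sup>2) ^ d" using lim by (simp add: \<rho>_def)
    also have "\<dots> \<le> expected_f0 (n d) d / ?N"
      using expected_f0_ge[OF \<rho>, of "n d" d] N by (simp add: pos_le_divide_eq mult.commute)
    finally show "a < expected_f0 (n d) d / ?N" .
  qed
qed

lemma expected_f0_ratio_upper:
  fixes n :: "nat \<Rightarrow> nat"
  assumes x: "0 < x" "x < y" and e: "e \<longlonglongrightarrow> 0"
    and n: "\<And>d. d \<ge> 2 \<Longrightarrow> real (n d) = (real d / (2 * x + e d)) powr (real d / 2)"
    and a: "1 - exp (- y) < a"
  shows "eventually (\<lambda>d. expected_f0 (n d) d / real (n d) < a) sequentially"
proof -
  \<comment> \<open>A quarter of the gap, so that each loss has its own share: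
    \<open>e d < r\<close> perturbs \<open>n\<close>, \<open>x + r\<close> enters the radius
    \<open>s\<close>, \<open>x + 2 * r\<close> the cap height \<open>\<tau>\<close>, and
    \<open>y = x + 4 * r\<close> the norm bound \<open>\<rho>\<close>.\<close>
  define r where "r = (y - x) / 4"
  have r: "r > 0" and y: "y = x + 4 * r" using x by (simp_all add: r_def field_simps)
  \<comment> \<open>A fixed bound above 1 from below for \<open>2 * (x + r) / (2 * x + e d)\<close>,
    valid once \<open>e d < r\<close>.\<close>
  define q where "q = 2 * (x + r) / (2 * x + r)"
  have q: "1 < q" using x r by (simp add: q_def)
  \<comment> \<open>The grid with \<open>m = d ^ 3\<close> has at most
    \<open>(2 * d ^ 3 + 1) ^ d\<close> vectors; the exponent bounds \<open>n * p\<close> from below,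
    where the cap probability is at least \<open>p = s ^ d / (2 * d)\<close>.\<close>
  let ?err = "\<lambda>d. (2 * real d ^ 3 + 1) powr real d * exp (- (q powr (real d / 2) / (2 * real d)))"
  have "(\<lambda>d. 1 - (1 + (- y) / real d) ^ d + ?err d) \<longlonglongrightarrow> 1 - exp (- y) + 0"
  proof (intro tendsto_add tendsto_diff tendsto_const tendsto_exp_limit_sequentially)
    show "?err \<longlonglongrightarrow> 0" using q by real_asymp
  qed
  then have lim: "eventually (\<lambda>d. 1 - (1 + (- y) / real d) ^ d + ?err d < a) sequentially"
    using a by (intro order_tendstoD) auto
  have e1: "eventually (\<lambda>d. e d < r) sequentially" using e r by (intro order_tendstoD(2)[OF e]) auto
  have e2: "eventually (\<lambda>d. - x < e d) sequentially" using e x by (intro order_tendstoD(1)[OF e]) auto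
  \<comment> \<open>The lower bounds on \<open>d\<close> from \<open>y\<close> onwards serve mainly,
    in this order, \<open>\<rho> > 0\<close>, the quadratic term in \<open>room\<close>, the fact
    \<open>slab\<close>, the fact \<open>grid_scale\<close>, and \<open>s \<le> 1\<close>.\<close>
  show ?thesis
    using lim e1 e2 eventually_ge_at_top[of 2] eventually_real_gt[of y]
      eventually_real_gt[of "(x + 2 * r)\<^sup>2 / r"] eventually_real_gt[of "32 * (x + r) / r\<^sup>2"]
      eventually_real_gt[of "2 / r"] eventually_real_gt[of "2 * (x + r)"]
  proof eventually_elim
    fix d assume lim: "1 - (1 + (- y) / real d) ^ d + ?err d < a" and ed: "e d < r" "- x < e d"
      and d: "2 \<le> d" "y < real d" "(x + 2 * r)\<^sup>2 / r < real d" "32 * (x + r) / r\<^sup>2 < real d"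
        "2 / r < real d" "2 * (x + r) < real d"
    let ?N = "real (n d)" and ?D = "real d"
    have D: "?D > 0" using d by simp
    have pos: "2 * x + e d > 0" using ed x by simp
    then have N: "?N > 0" using d x by (simp add: n)
    \<comment> \<open>The difference \<open>\<tau> - \<rho>\<close> is \<open>2 * r / d\<close> and
      has to exceed \<open>2 * \<delta> = r / d\<close>: one \<open>\<delta>\<close> for replacing
      the normal by a grid vector, one for the norm of that vector, which may drop to
      \<open>1 - \<delta>\<close>.\<close>
    define \<rho> where "\<rho> = 1 - y / ?D"
    define \<delta> where "\<delta> = r / (2 * ?D)"
    define \<tau> where "\<tau> = 1 - (x + 2 * r) / ?D"
    define s where "s = sqrt (2 * (x + r) / ?D)"
    define \<eta> where "\<eta> = r / (4 * ?D)"
    define t where "t = \<tau> * (1 - \<delta>)"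
    define p where "p = s ^ d / (2 * ?D)"
    have \<rho>: "0 < \<rho>" "\<rho> \<le> 1" using x d by (auto simp: \<rho>_def)
    have \<tau>: "0 \<le> \<tau>" "\<tau> \<le> 1" using x d D r y by (auto simp: \<tau>_def)
    have \<delta>: "0 < \<delta>" "\<delta> < 1" using d r D y x by (auto simp: \<delta>_def)
    have s: "0 < s" "s\<^sup>2 = 2 * (x + r) / ?D" "s \<le> 1" using x r D d by (auto simp: s_def)
    \<comment> \<open>With \<open>m = d ^ 3\<close> the rounding error is \<open>1 / d ^ 2\<close>,
      of smaller order than \<open>\<delta>\<close>; \<open>m = d ^ 2\<close> would only give
      \<open>1 / d\<close>, too coarse for small \<open>r\<close>.\<close>
    have grid_scale: "real d / real (d ^ 3) \<le> \<delta>"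
    proof -
      have "2 < r * ?D" using d(5) r by (simp add: field_simps)
      then have "2 * (?D * ?D) \<le> (r * ?D) * (?D * ?D)" by (intro mult_right_mono) auto
      then show ?thesis using D by (simp add: \<delta>_def field_simps power3_eq_cube)
    qed
    have gap: "\<rho> + \<delta> < t"
    proof -
      have "\<tau> * \<delta> \<le> 1 * \<delta>" using \<tau> \<delta> by (intro mult_right_mono) auto
      then have "\<tau> - \<delta> \<le> t" by (simp add: t_def algebra_simps)
      moreover have "\<rho> + \<delta> + \<delta> < \<tau>"
        using r D y by (simp add: \<rho>_def \<tau>_def \<delta>_def field_simps)
      ultimately show ?thesis by linarith
    qed
    \<comment> \<open>Here \<open>K = d\<close>: that many slabs reach the fixed level
      \<open>r / 4\<close>, whereas \<open>s\<close> tends to 0. The cost is the denominator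
      \<open>2 * d\<close> in \<open>p\<close>.\<close>
    have slab: "s < real d * \<eta>"
    proof -
      have "s\<^sup>2 < (r / 4)\<^sup>2"
        using d(4) r D unfolding s(2) by (simp add: field_simps power2_eq_square)
      then have "s < r / 4" by (rule power2_less_imp_less) (use r in simp)
      then show ?thesis using D by (simp add: \<eta>_def)
    qed
    \<comment> \<open>Up to the square of \<open>(x + 2 * r) / d\<close>, the difference
      \<open>1 - \<tau>\<^sup>2 - s\<^sup>2\<close> is \<open>2 * r / d\<close>; the cross term uses
      at most \<open>r / (2 * d)\<close> of it and that square at most \<open>r / d\<close>.\<close>
    have room: "s\<^sup>2 + 2 * \<tau> * \<eta> + \<tau>\<^sup>2 \<le> 1"
    proof -
      have "\<tau> * (2 * \<eta>) \<le> 1 * (2 * \<eta>)"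
        using \<tau> r D by (intro mult_right_mono) (auto simp: \<eta>_def)
      then have "2 * \<tau> * \<eta> \<le> 2 * \<eta>" by (simp add: ac_simps)
      moreover have "\<tau>\<^sup>2 = 1 - 2 * (x + 2 * r) / ?D + (x + 2 * r)\<^sup>2 / ?D / ?D"
      proof -
        have "\<tau>\<^sup>2 = 1 - 2 * ((x + 2 * r) / ?D) + ((x + 2 * r) / ?D)\<^sup>2"
          by (simp only: \<tau>_def power2_diff) simp
        then show ?thesis by (simp add: power2_eq_square)
      qed
      moreover have "(x + 2 * r)\<^sup>2 / ?D / ?D \<le> r / ?D"
        using d(3) r D by (intro divide_right_mono) (auto simp: field_simps)
      moreover have "2 * (x + r) / ?D + 2 * \<eta> - 2 * (x + 2 * r) / ?D + r / ?D \<le> 0"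
        using D r by (simp add: \<eta>_def field_simps)
      ultimately show ?thesis using s(2) by linarith
    qed
    have "expected_f0 (n d) d \<le> ?N * (1 - \<rho> ^ d + (2 * real (d ^ 3) + 1) ^ d * (1 - p) ^ n d)"
    proof (rule expected_f0_le[OF _ \<rho> _ grid_scale gap])
      fix u assume u: "1 - \<delta> \<le> L2_set u {..<d}"
      show "p \<le> measure (unif_ball d) {y \<in> unit_ball d. t \<le> inner_on d u y}"
        unfolding p_def
      proof (rule measure_cap_ge[OF _ _ s(1) _ slab \<tau>(1) room])
        show "0 < L2_set u {..<d}" using u \<delta> by linarith
        show "t \<le> \<tau> * L2_set u {..<d}" unfolding t_def using u \<tau> by (intro mult_left_mono) auto
        show "0 < \<eta>" using r D by (simp add: \<eta>_def)
      qed
    qed (use d in auto)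
    then have "expected_f0 (n d) d / ?N \<le> 1 - \<rho> ^ d + (2 * ?D ^ 3 + 1) ^ d * (1 - p) ^ n d"
      using N by (simp add: pos_divide_le_eq mult.commute)
    also have "(2 * ?D ^ 3 + 1) ^ d * (1 - p) ^ n d \<le> ?err d"
    proof (rule mult_mono)
      show "(2 * ?D ^ 3 + 1) ^ d \<le> (2 * ?D ^ 3 + 1) powr ?D"
        by (subst powr_realpow) (auto intro: add_nonneg_pos)
      \<comment> \<open>The base \<open>1 - p\<close> must be nonnegative before
        \<open>1 - p \<le> exp (- p)\<close> can be raised to the power \<open>n d\<close>.\<close>
      have "s ^ d \<le> 1" using s by (simp add: power_le_one)
      then have p: "p \<le> 1" using d by (simp add: p_def)
      then have "(1 - p) ^ n d \<le> exp (- p) ^ n d"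
        using exp_ge_add_one_self[of "- p"] by (intro power_mono) auto
      also have "\<dots> = exp (- (?N * p))" by (simp flip: exp_of_nat_mult)
      also have "\<dots> \<le> exp (- (q powr (?D / 2) / (2 * ?D)))"
      proof -
        have "?N * s ^ d = (2 * (x + r) / (2 * x + e d)) powr (?D / 2)"
          unfolding n[OF d(1)] using x r d pos s by (intro powr_half_mult_power) auto
        moreover have "q powr (?D / 2) \<le> (2 * (x + r) / (2 * x + e d)) powr (?D / 2)"
        proof (intro powr_mono2)
          show "q \<le> 2 * (x + r) / (2 * x + e d)"
            unfolding q_def using ed pos x r by (intro divide_left_mono) auto
        qed (use q in auto)
        ultimately have "q powr (?D / 2) / (2 * ?D) \<le> ?N * s ^ d / (2 * ?D)"
          using D by (intro divide_right_mono) auto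
        then show ?thesis by (simp add: p_def)
      qed
      finally show "(1 - p) ^ n d \<le> exp (- (q powr (?D / 2) / (2 * ?D)))" .
      show "0 \<le> (1 - p) ^ n d" using p by simp
    qed simp
    finally show "expected_f0 (n d) d / ?N < a" using lim by (simp add: \<rho>_def)
  qed
qed

theorem corollary3p3:
  fixes x :: real and n :: "nat \<Rightarrow> nat" and e :: "nat \<Rightarrow> real"
  assumes "x > 0"
    and "e \<longlonglongrightarrow> 0"
    and "\<And>d. d \<ge> 2 \<Longrightarrow> real (n d) = (real d / (2 * x + e d)) powr (real d / 2)"
  shows "(\<lambda>d. expected_f0 (n d) d) \<sim>[sequentially] (\<lambda>d. (1 - exp (- x)) * real (n d))"
proof -
  let ?L = "1 - exp (- x)"
  have continuous: "((\<lambda>y. 1 - exp (- y)) \<longlongrightarrow> ?L) (at x within S)" for S :: "real set"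
    by (intro tendsto_intros)
  \<comment> \<open>The two ratio bounds require \<open>y < x\<close> and \<open>x < y\<close>. By
    continuity a number strictly below or above the limit is still on the same side of
    \<open>1 - exp (- y)\<close> for some \<open>y\<close> close to \<open>x\<close> on the required
    side.\<close>
  have lim: "(\<lambda>d. expected_f0 (n d) d / real (n d)) \<longlonglongrightarrow> ?L"
  proof (rule order_tendstoI)
    fix a assume a: "a < ?L"
    have "eventually (\<lambda>y. a < 1 - exp (- y)) (at_left x)"
      using continuous a by (rule order_tendstoD)
    moreover have "eventually (\<lambda>y. y \<in> {0<..<x}) (at_left x)"
      by (rule eventually_at_leftI[of 0]) (use \<open>x > 0\<close> in auto)
    ultimately have "eventually (\<lambda>y. y \<in> {0<..<x} \<and> a < 1 - exp (- y)) (at_left x)"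
      by eventually_elim auto
    then obtain y where "0 < y" "y < x" "a < 1 - exp (- y)"
      using eventually_happens'[OF trivial_limit_at_left_real] by auto
    then show "eventually (\<lambda>d. a < expected_f0 (n d) d / real (n d)) sequentially"
      using assms(2,3) by (intro expected_f0_ratio_lower) auto
  next
    fix a assume a: "?L < a"
    have "eventually (\<lambda>y. 1 - exp (- y) < a) (at_right x)"
      using continuous a by (rule order_tendstoD)
    moreover have "eventually (\<lambda>y. x < y) (at_right x)"
      by (rule eventually_at_right_less)
    ultimately have "eventually (\<lambda>y. x < y \<and> 1 - exp (- y) < a) (at_right x)"
      by eventually_elim auto
    then obtain y where "x < y" "1 - exp (- y) < a"
      using eventually_happens'[OF trivial_limit_at_right_real] by auto
    then show "eventually (\<lambda>d. expected_f0 (n d) d / real (n d) < a) sequentially"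
      using assms by (intro expected_f0_ratio_upper) auto
  qed
  have "(\<lambda>d. expected_f0 (n d) d / real (n d) / ?L) \<longlonglongrightarrow> ?L / ?L"
    using \<open>x > 0\<close> by (intro tendsto_divide lim tendsto_const) auto
  then show ?thesis
    using \<open>x > 0\<close> by (intro asymp_equivI') (simp add: mult.commute)
qed

end
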